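(* Assume that for every Coxeter group $W$ and all $u<v$ in the Bruhat order on $W$, all coefficients of the cd-index $\Phi_{[u,v]}$ (as a linear combination of cd-monomials) are non-negative. Then for any Coxeter group $W$ and any $w\in W$ with $w\ne1$, $$\Phi_{[1,w]}\le\Phi_{B_{l(w)}},$$ where $\le$ denotes coefficientwise comparison of cd-polynomials.
   Context: $l$ is the length function, $[1,w]$ is the lower interval in Bruhat order (fixing a reduced word for $w$, $v\le w$ iff some subword is a reduced word for $v$), and $B_n$ is the Boolean algebra of rank $n$ (all subsets of an $n$-element set ordered by inclusion). cd-index. For a finite graded poset $P$ of rank $n+1\ge1$ with minimum $\hat0$ and maximum $\hat1$ and $S\subseteq[n]$, let $\alpha_P(S)$ be the number of chains in $P\setminus\{\hat0,\hat1\}$ whose set of ranks is $S$, and $\beta_P(S)=\sum_{T\subseteq S}(-1)^{|S\setminus T|}\alpha_P(T)$. Let $u_S=u_1\cdots u_n$ be the monomial in non-commuting variables $a,b$ with $u_i=b$ if $i\in S$ and $u_i=a$ otherwise; set $\Psi_P=\sum_{S\subseteq[n]}\beta_P(S)u_S$. If $P$ is Eulerian (in particular a Bruhat interval or Boolean algebra), $\Psi_P$ can be written uniquely as a polynomial $\Phi_P$ in the non-commuting variables $c=a+b$ and $d=ab+ba$, called the cd-index of $P$. *)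

theory Defs
  imports
    "HOL-Library.Poly_Mapping"
    "HOL-Library.Sublist"
    "HOL-Algebra.Generated_Groups"
begin

section \<open>Coxeter groups, length and Bruhat order\<close>

definition word_value :: "'a monoid \<Rightarrow> 'a list \<Rightarrow> 'a" where
  "word_value W xs = foldr (\<otimes>\<^bsub>W\<^esub>) xs \<one>\<^bsub>W\<^esub>"

text \<open>
  A Coxeter matrix \<open>m\<close> on the generators \<open>S\<close>. The entry \<open>0\<close> stands for infinity; its
  relator \<open>(s t)\<^sup>0\<close> is the empty word, so it imposes no relation.
\<close>

definition coxeter_matrix :: "'a set \<Rightarrow> ('a \<Rightarrow> 'a \<Rightarrow> nat) \<Rightarrow> bool" where
  "coxeter_matrix S m \<longleftrightarrow>
     (\<forall>s\<in>S. \<forall>t\<in>S. m s t = m t s \<and> (m s t = 1 \<longleftrightarrow> s = t))"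

definition relator_deletion :: "'a set \<Rightarrow> ('a \<Rightarrow> 'a \<Rightarrow> nat) \<Rightarrow> 'a list \<Rightarrow> 'a list \<Rightarrow> bool" where
  "relator_deletion S m xs ys \<longleftrightarrow>
     (\<exists>ps\<in>lists S. \<exists>qs\<in>lists S. \<exists>s\<in>S. \<exists>t\<in>S.
        xs = ps @ concat (replicate (m s t) [s, t]) @ qs \<and> ys = ps @ qs)"

text \<open>
  The presentation of \<open>W\<close> with generators \<open>S\<close> and relations \<open>(s t)\<^bsup>m s t\<^esup> = 1\<close>. Since the
  relations include \<open>s\<^sup>2 = 1\<close>, the presented group is the quotient of the free monoid of
  words in \<open>S\<close> by insertion and deletion of the relators; formal inverses are not needed.
\<close>

locale coxeter_system = group W for W :: "'a monoid" (structure) +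
  fixes S :: "'a set"
  assumes generators_closed: "S \<subseteq> carrier W"
    and generators_generate: "generate W S = carrier W"
    and presentation: "\<exists>m. coxeter_matrix S m \<and>
      (\<forall>xs\<in>lists S. \<forall>ys\<in>lists S.
         word_value W xs = word_value W ys \<longleftrightarrow> equivclp (relator_deletion S m) xs ys)"

definition cox_length :: "'a monoid \<Rightarrow> 'a set \<Rightarrow> 'a \<Rightarrow> nat" where
  "cox_length W S w = (LEAST n. \<exists>xs\<in>lists S. word_value W xs = w \<and> length xs = n)"

definition reduced_word :: "'a monoid \<Rightarrow> 'a set \<Rightarrow> 'a \<Rightarrow> 'a list \<Rightarrow> bool" where
  "reduced_word W S w xs \<longleftrightarrow>
     xs \<in> lists S \<and> word_value W xs = w \<and> length xs = cox_length W S w"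

text \<open>
  By the subword property, the choice of the reduced word for the larger element is
  immaterial.
\<close>

definition bruhat_le :: "'a monoid \<Rightarrow> 'a set \<Rightarrow> 'a \<Rightarrow> 'a \<Rightarrow> bool" where
  "bruhat_le W S v w \<longleftrightarrow>
     (\<exists>xs ys. reduced_word W S w xs \<and> subseq ys xs \<and> reduced_word W S v ys)"

definition bruhat_order :: "'a monoid \<Rightarrow> 'a set \<Rightarrow> 'a gorder" where
  "bruhat_order W S = \<lparr>carrier = carrier W, eq = (=), le = bruhat_le W S\<rparr>"

definition interval_poset :: "'a gorder \<Rightarrow> 'a \<Rightarrow> 'a \<Rightarrow> 'a gorder" where
  "interval_poset L u v = L\<lparr>carrier := at_least_at_most L u v\<rparr>"

definition boolean_algebra_poset :: "nat \<Rightarrow> nat set gorder" where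
  "boolean_algebra_poset n = \<lparr>carrier = Pow {..<n}, eq = (=), le = (\<subseteq>)\<rparr>"


section \<open>Polynomials in non-commuting variables\<close>

datatype 'x monomial = Monomial (letters: "'x list")

text \<open>
  The free monoid is written additively, so that the product of \<open>poly_mapping\<close> becomes
  the (non-commutative) product of the free algebra.
\<close>

instantiation monomial :: (type) monoid_add
begin

definition "0 = Monomial []"

definition "u + v = Monomial (letters u @ letters v)"

instance
  by standard (simp_all add: zero_monomial_def plus_monomial_def)

end

type_synonym 'x ncpoly = "'x monomial \<Rightarrow>\<^sub>0 int"

definition nc_var :: "'x \<Rightarrow> 'x ncpoly" where
  "nc_var x = Poly_Mapping.single (Monomial [x]) 1"

definition nc_subst :: "('x \<Rightarrow> 'y ncpoly) \<Rightarrow> 'x ncpoly \<Rightarrow> 'y ncpoly" where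
  "nc_subst f p = (\<Sum>u\<in>Poly_Mapping.keys p.
     of_int (Poly_Mapping.lookup p u) * prod_list (map f (letters u)))"

definition coeffs_nonneg :: "'x ncpoly \<Rightarrow> bool" where
  "coeffs_nonneg p \<longleftrightarrow> (\<forall>u. 0 \<le> Poly_Mapping.lookup p u)"

text \<open>The order \<open>\<le>\<close> that the library puts on \<open>poly_mapping\<close> is lexicographic.\<close>

definition coeffs_le :: "'x ncpoly \<Rightarrow> 'x ncpoly \<Rightarrow> bool" where
  "coeffs_le p q \<longleftrightarrow> (\<forall>u. Poly_Mapping.lookup p u \<le> Poly_Mapping.lookup q u)"


section \<open>The cd-index\<close>

text \<open>
  In a finite graded poset with minimum, the rank of \<open>x\<close> is the largest number of elements
  of a chain strictly below \<open>x\<close>.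
\<close>

definition poset_rank :: "'p gorder \<Rightarrow> 'p \<Rightarrow> nat" where
  "poset_rank P x = Max (card `
     {C. C \<subseteq> {y \<in> carrier P. y \<sqsubset>\<^bsub>P\<^esub> x} \<and> Complete_Partial_Order.chain (le P) C})"

definition flag_f :: "'p gorder \<Rightarrow> nat set \<Rightarrow> nat" where
  "flag_f P T = card {C. C \<subseteq> carrier P - {\<bottom>\<^bsub>P\<^esub>, \<top>\<^bsub>P\<^esub>} \<and>
     Complete_Partial_Order.chain (le P) C \<and> poset_rank P ` C = T}"

definition flag_h :: "'p gorder \<Rightarrow> nat set \<Rightarrow> int" where
  "flag_h P T = (\<Sum>R\<in>Pow T. (-1) ^ card (T - R) * int (flag_f P R))"

datatype ab = A_letter | B_letter

datatype cd = C_letter | D_letter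

definition ab_monomial :: "nat \<Rightarrow> nat set \<Rightarrow> ab ncpoly" where
  "ab_monomial n T =
     prod_list (map (\<lambda>i. nc_var (if i \<in> T then B_letter else A_letter)) [1..<n + 1])"

text \<open>Here \<open>n\<close> is one less than the rank of the poset.\<close>

definition ab_index :: "'p gorder \<Rightarrow> ab ncpoly" where
  "ab_index P = (let n = poset_rank P \<top>\<^bsub>P\<^esub> - 1 in
     \<Sum>T\<in>Pow {1..n}. of_int (flag_h P T) * ab_monomial n T)"

fun cd_in_ab :: "cd \<Rightarrow> ab ncpoly" where
  "cd_in_ab C_letter = nc_var A_letter + nc_var B_letter"
| "cd_in_ab D_letter = nc_var A_letter * nc_var B_letter + nc_var B_letter * nc_var A_letter"

text \<open>Well-defined for Eulerian posets, in particular for Bruhat intervals and Boolean algebras.\<close>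

definition cd_index :: "'p gorder \<Rightarrow> cd ncpoly" where
  "cd_index P = (THE p. nc_subst cd_in_ab p = ab_index P)"

end

theory Submission
  imports Defs
begin

text \<open>
  Write \<open>\<Psi>\<close> and \<open>\<Phi>\<close> for ab-index and cd-index, and put \<open>e = a - b\<close>. Let \<open>s\<close> be a generator
  with \<open>l(w) < l(ws)\<close> and \<open>w \<noteq> 1\<close>. The heart of the proof is the identity
  \<open>\<Phi>[1,ws] = c \<Phi>[1,w] + G(\<Phi>[1,w]) - (\<Sum>v. \<Phi>[1,v] d \<Phi>[v,w])\<close>,
  where \<open>v\<close> ranges over \<open>1 < v < w\<close> with \<open>vs < v\<close>, and \<open>G\<close> is the derivation with \<open>G(c) = d\<close>
  and \<open>G(d) = dc\<close> (lemma \<open>phi_lifting_recursion\<close>). If all cd-indices of Bruhat intervals are non-negative, then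
  so is the sum, hence \<open>\<Phi>[1,ws] \<le> c \<Phi>[1,w] + G(\<Phi>[1,w])\<close>. For Boolean algebras the same
  identity holds with an empty sum, because no subset of \<open>{0,...,n-1}\<close> contains the point \<open>n\<close> that
  is added to it; so \<open>\<Phi>(B\<^sub>n\<^sub>+\<^sub>1) = c \<Phi>(B\<^sub>n) + G(\<Phi>(B\<^sub>n))\<close>. The operator \<open>p \<mapsto> c p + G(p)\<close>
  (on cd-indices it is the passage to the product with a two-element chain) preserves
  non-negativity of coefficients, hence coefficientwise inequalities, and induction on the length
  gives the theorem.

  The identity for Bruhat order and the one for Boolean algebras are the same statement about
  posets with involutions that satisfy the lifting property: multiplication by a generator in
  the first case, insertion or removal of a point in the second. They are therefore proved once,
  in the locale \<open>lifting_poset\<close>. There \<open>\<Psi>\<close> is a sum over chains and satisfies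
  \<open>\<Psi>[u,y] = e\<^sup>k + (\<Sum>x. \<Psi>[u,x] b e\<^sup>j)\<close> with \<open>x\<close> the largest element of the chain (\<open>psi_rec\<close>).
  For an involution \<open>s\<close> that raises \<open>u\<close>, this recursion gives, by induction on the rank of \<open>y\<close>, the
  value of
  \<open>b \<Psi>[u,y] + \<Psi>[u,y] a + (\<Sum>v. \<Psi>[u,v] A\<^sub>v \<Psi>[v,y])\<close>,
  where \<open>A\<^sub>v\<close> is \<open>ab\<close> if \<open>s\<close> raises \<open>v\<close> and \<open>-ba\<close> if it lowers \<open>v\<close>: it is
  \<open>\<Psi>[u,sy]\<close> if \<open>s\<close> raises \<open>y\<close> and \<open>\<Psi>[u,y] c\<close> otherwise (\<open>lifted_eq\<close>). The second case
  is what makes the induction work. Since \<open>-ba = ab - d\<close> and the sum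
  of all \<open>\<Psi>[u,v] ab \<Psi>[v,y]\<close> is a derivation applied to \<open>\<Psi>[u,y]\<close> up to a commutator with \<open>a\<close>
  (\<open>ab_deriv_psi\<close>), this is the identity above in terms of \<open>a\<close> and \<open>b\<close>.

  To pass to cd-indices, the lifting property also yields that every interval is Eulerian
  (\<open>eulerian\<close>) and that the poset is graded (\<open>exists_cover\<close>), so that \<open>\<Psi>\<close> is the ab-index and lies
  in the subring generated by \<open>c\<close> and \<open>d\<close> (\<open>psi_in_cd\<close>), which is free on them
  (\<open>nc_subst_cd_inject\<close>).

  That Bruhat order has the lifting property is derived from the presentation: the parity of
  the number of times a reflection occurs in the inversion list of a word does not change when a
  relator is deleted (\<open>parity_count_inversions\<close>). This gives the strong exchange property, and
  with it the equivalence of the subword order with the order generated by multiplication by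
  reflections (\<open>bruhat_le_iff\<close>).
\<close>

section \<open>The free algebra and its substitutions\<close>

abbreviation (input) word :: "'x list \<Rightarrow> 'x ncpoly" where
  "word xs \<equiv> frag_of (Monomial xs)"

lemma word_Nil: "word [] = (1 :: 'x ncpoly)"
  by (simp flip: zero_monomial_def single_one)

lemma word_append: "word (xs @ ys) = (word xs * word ys :: 'x ncpoly)"
  by (simp add: mult_single plus_monomial_def)

lemma word_Cons: "word (x # xs) = nc_var x * (word xs :: 'x ncpoly)"
  using word_append[of "[x]" xs] by (simp add: nc_var_def)

lemma nc_var_word: "nc_var x = word [x]"
  by (simp add: nc_var_def)

text \<open>
  An additive map is determined by its values on words: identities that are additive in \<open>p\<close>
  need only be checked on words.
\<close>

lemma ncpoly_induct [case_names zero word diff]: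
  fixes p :: "'x ncpoly"
  assumes "P 0" "\<And>xs. P (word xs)" "\<And>p q. P p \<Longrightarrow> P q \<Longrightarrow> P (p - q)"
  shows "P p"
proof (rule frag_induction[of p UNIV])
  show "P (frag_of u)" for u :: "'x monomial"
    using assms(2)[of "letters u"] by simp
qed (use assms in auto)

lemma of_int_mult_conv_frag_cmul: "of_int k * p = frag_cmul k (p :: 'x ncpoly)"
proof -
  have "of_int k * p = Poly_Mapping.single 0 k * p"
    by (metis single_of_int of_int_eq_id id_apply)
  also have "\<dots> = Poly_Mapping.map ((*) k) p"
    by (simp add: mult_map_scale_conv_mult)
  also have "\<dots> = frag_cmul k p"
    by (rule poly_mapping_eqI) (simp add: Poly_Mapping.map.rep_eq when_def)
  finally show ?thesis .
qed

lemma nc_subst_conv_frag_extend: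
  "nc_subst f = frag_extend (\<lambda>u. prod_list (map f (letters u)))"
  by (auto simp: nc_subst_def frag_extend_def of_int_mult_conv_frag_cmul fun_eq_iff)

lemma nc_subst_word [simp]: "nc_subst f (word xs) = prod_list (map f xs)"
  by (simp add: nc_subst_conv_frag_extend)

lemma nc_subst_0 [simp]: "nc_subst f 0 = 0"
  by (simp add: nc_subst_conv_frag_extend)

lemma nc_subst_diff: "nc_subst f (p - q) = nc_subst f p - nc_subst f q"
  by (simp add: nc_subst_conv_frag_extend frag_extend_diff)

lemma nc_subst_add: "nc_subst f (p + q) = nc_subst f p + nc_subst f q"
  by (simp add: nc_subst_conv_frag_extend frag_extend_add)

lemma nc_subst_mult: "nc_subst f (p * q) = nc_subst f p * nc_subst f q"
proof (induction p rule: ncpoly_induct)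
  case (word xs)
  show ?case
  proof (induction q rule: ncpoly_induct)
    case (word ys)
    show ?case
      by (simp flip: word_append)
  qed (simp_all add: nc_subst_diff algebra_simps)
qed (simp_all add: nc_subst_diff algebra_simps)

lemma nc_subst_1 [simp]: "nc_subst f 1 = 1"
  using nc_subst_word[of f "[]"] by (simp add: word_Nil del: nc_subst_word)

lemma nc_subst_of_int: "nc_subst f (of_int k) = of_int k"
proof -
  have const: "of_int k = frag_cmul k (1 :: 'z ncpoly)" for k
    using of_int_mult_conv_frag_cmul[of k 1] by simp
  have "frag_cmul k (nc_subst f 1) = nc_subst f (frag_cmul k 1)"
    unfolding nc_subst_conv_frag_extend by (simp only: frag_extend_cmul)
  then show ?thesis
    by (simp add: const)
qed

lemma nc_subst_var [simp]: "nc_subst f (nc_var x) = f x"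
  by (simp add: nc_var_word)

lemma nc_subst_sum: "nc_subst f (sum g A) = (\<Sum>x\<in>A. nc_subst f (g x))"
  by (induction A rule: infinite_finite_induct) (simp_all add: nc_subst_add)


section \<open>Derivations\<close>

fun word_deriv :: "('x \<Rightarrow> 'x ncpoly) \<Rightarrow> 'x list \<Rightarrow> 'x ncpoly" where
  "word_deriv \<delta> [] = 0"
| "word_deriv \<delta> (x # xs) = \<delta> x * word xs + nc_var x * word_deriv \<delta> xs"

text \<open>
  The derivation that sends each variable \<open>x\<close> to \<open>\<delta> x\<close>.
\<close>

definition nc_deriv :: "('x \<Rightarrow> 'x ncpoly) \<Rightarrow> 'x ncpoly \<Rightarrow> 'x ncpoly" where
  "nc_deriv \<delta> = frag_extend (\<lambda>u. word_deriv \<delta> (letters u))"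

lemma nc_deriv_word: "nc_deriv \<delta> (word xs) = word_deriv \<delta> xs"
  by (simp add: nc_deriv_def)

lemma nc_deriv_0 [simp]: "nc_deriv \<delta> 0 = 0"
  by (simp add: nc_deriv_def)

lemma nc_deriv_diff: "nc_deriv \<delta> (p - q) = nc_deriv \<delta> p - nc_deriv \<delta> q"
  by (simp add: nc_deriv_def frag_extend_diff)

lemma nc_deriv_add: "nc_deriv \<delta> (p + q) = nc_deriv \<delta> p + nc_deriv \<delta> q"
  by (simp add: nc_deriv_def frag_extend_add)

lemma nc_deriv_sum: "nc_deriv \<delta> (sum g A) = (\<Sum>x\<in>A. nc_deriv \<delta> (g x))"
  by (induction A rule: infinite_finite_induct) (simp_all add: nc_deriv_add)

lemma word_deriv_append:
  "word_deriv \<delta> (xs @ ys) = word_deriv \<delta> xs * word ys + word xs * word_deriv \<delta> ys"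
  by (induction xs) (simp_all add: word_Nil word_Cons word_append algebra_simps)

lemma nc_deriv_mult: "nc_deriv \<delta> (p * q) = nc_deriv \<delta> p * q + p * nc_deriv \<delta> q"
proof (induction p rule: ncpoly_induct)
  case (word xs)
  show ?case
  proof (induction q rule: ncpoly_induct)
    case (word ys)
    show ?case
      by (simp add: nc_deriv_word word_deriv_append flip: word_append)
  qed (simp_all add: nc_deriv_diff algebra_simps)
qed (simp_all add: nc_deriv_diff algebra_simps)

lemma nc_deriv_var [simp]: "nc_deriv \<delta> (nc_var x) = \<delta> x"
  by (simp add: nc_var_word nc_deriv_word word_Nil)

lemma nc_deriv_1 [simp]: "nc_deriv \<delta> 1 = 0"
  by (simp add: nc_deriv_word flip: word_Nil)

text \<open>
  Both sides are derivations along \<open>f\<close>, so it suffices that they agree on the variables. This is how a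
  derivation of ab-polynomials is computed on cd-polynomials.
\<close>

lemma nc_deriv_subst:
  assumes "\<And>x. nc_deriv \<delta> (f x) = nc_subst f (\<gamma> x)"
  shows "nc_deriv \<delta> (nc_subst f p) = nc_subst f (nc_deriv \<gamma> p)"
proof (induction p rule: ncpoly_induct)
  case (word xs)
  show ?case
    by (induction xs)
       (simp_all add: nc_deriv_word nc_subst_add nc_subst_mult nc_deriv_mult assms word_Nil)
qed (simp_all add: nc_deriv_diff nc_subst_diff)


section \<open>Non-negative coefficients\<close>

lemma coeffs_nonneg_0 [simp]: "coeffs_nonneg 0"
  by (simp add: coeffs_nonneg_def)

lemma coeffs_nonneg_word [simp]: "coeffs_nonneg (word xs)"
  by (simp add: coeffs_nonneg_def lookup_single when_def)

lemma coeffs_nonneg_var [simp]: "coeffs_nonneg (nc_var x)"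
  by (simp add: nc_var_word)

lemma coeffs_nonneg_add: "coeffs_nonneg p \<Longrightarrow> coeffs_nonneg q \<Longrightarrow> coeffs_nonneg (p + q)"
  by (simp add: coeffs_nonneg_def lookup_add)

lemma coeffs_nonneg_sum: "(\<And>x. x \<in> A \<Longrightarrow> coeffs_nonneg (g x)) \<Longrightarrow> coeffs_nonneg (sum g A)"
  by (induction A rule: infinite_finite_induct) (simp_all add: coeffs_nonneg_add)

lemma coeffs_nonneg_mult:
  assumes "coeffs_nonneg p" "coeffs_nonneg q"
  shows "coeffs_nonneg (p * q)"
  using assms unfolding coeffs_nonneg_def lookup_mult Sum_any.expand_set
  by (auto intro!: sum_nonneg mult_nonneg_nonneg simp: when_def)

lemma coeffs_le_iff_nonneg_diff: "coeffs_le p q \<longleftrightarrow> coeffs_nonneg (q - p)"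
  by (simp add: coeffs_le_def coeffs_nonneg_def lookup_minus)

lemma coeffs_nonneg_deriv:
  assumes "\<And>x. coeffs_nonneg (\<delta> x)" "coeffs_nonneg p"
  shows "coeffs_nonneg (nc_deriv \<delta> p)"
proof -
  have *: "coeffs_nonneg (word_deriv \<delta> xs)" for xs
    by (induction xs) (simp_all add: assms coeffs_nonneg_add coeffs_nonneg_mult)
  show ?thesis
    using assms(2) * unfolding nc_deriv_def frag_extend_def coeffs_nonneg_def
    by (auto simp: lookup_sum intro!: sum_nonneg)
qed


section \<open>The subalgebra generated by c and d\<close>

text \<open>
  Stripping a leading letter \<open>x\<close>; words that do not start with \<open>x\<close> are dropped. It recovers the
  cofactors \<open>p\<^sub>x\<close> in \<open>p = k + (\<Sum>x. x p\<^sub>x)\<close>.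
\<close>

definition left_quotient :: "'x \<Rightarrow> 'x ncpoly \<Rightarrow> 'x ncpoly" where
  "left_quotient x = frag_extend (\<lambda>u. case letters u of [] \<Rightarrow> 0
     | y # ys \<Rightarrow> if y = x then word ys else 0)"

lemma left_quotient_diff: "left_quotient x (p - q) = left_quotient x p - left_quotient x q"
  by (simp add: left_quotient_def frag_extend_diff)

lemma left_quotient_add: "left_quotient x (p + q) = left_quotient x p + left_quotient x q"
  by (simp add: left_quotient_def frag_extend_add)

lemma left_quotient_0 [simp]: "left_quotient x 0 = 0"
  by (simp add: left_quotient_def)

lemma left_quotient_of_int [simp]: "left_quotient x (of_int k :: 'x ncpoly) = 0"
proof -
  have "(of_int k :: 'x ncpoly) = frag_cmul k (word [])"
    using of_int_mult_conv_frag_cmul[of k "1 :: 'x ncpoly"] by (simp add: word_Nil)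
  then show ?thesis
    unfolding left_quotient_def by (simp only: frag_extend_cmul frag_extend_of) simp
qed

lemma left_quotient_var_mult [simp]:
  "left_quotient x (nc_var y * p) = (if x = y then p else 0)"
proof (induction p rule: ncpoly_induct)
  case (word xs)
  show ?case
    unfolding word_Cons[symmetric] by (auto simp: left_quotient_def)
qed (simp_all add: left_quotient_diff algebra_simps)

lemma lookup_left_quotient:
  "Poly_Mapping.lookup (left_quotient x p) (Monomial xs) = Poly_Mapping.lookup p (Monomial (x # xs))"
proof (induction p rule: ncpoly_induct)
  case (word ys)
  show ?case
    by (cases ys) (auto simp: left_quotient_def lookup_single when_def)
qed (simp_all add: left_quotient_diff lookup_minus)

lemma cd_decomposition:
  fixes p :: "cd ncpoly"
  shows "p = of_int (Poly_Mapping.lookup p (Monomial []))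
    + nc_var C_letter * left_quotient C_letter p + nc_var D_letter * left_quotient D_letter p"
proof (induction p rule: ncpoly_induct)
  case (word xs)
  show ?case
  proof (cases xs)
    case (Cons x ys)
    then show ?thesis
      by (cases x) (simp_all add: left_quotient_def flip: word_Cons)
  next
    case Nil
    have "left_quotient y (word []) = 0" for y :: cd
      by (simp add: left_quotient_def)
    moreover have "Poly_Mapping.lookup (word [] :: cd ncpoly) (Monomial []) = 1"
      by simp
    ultimately show ?thesis
      unfolding Nil by (simp add: word_Nil)
  qed
next
  case (diff p q)
  show ?case
    by (subst diff(1), subst diff(2)) (simp add: left_quotient_diff lookup_minus algebra_simps)
qed simp

lemma lookup_var_mult:
  "Poly_Mapping.lookup (nc_var x * p) (Monomial xs) =
     (case xs of [] \<Rightarrow> 0 | y # ys \<Rightarrow> if y = x then Poly_Mapping.lookup p (Monomial ys) else 0)"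
proof (cases xs)
  case Nil
  have "Poly_Mapping.lookup (nc_var x * p) (Monomial []) = 0"
  proof (induction p rule: ncpoly_induct)
    case (word ys)
    show ?case
      by (simp flip: word_Cons)
  qed (simp_all add: algebra_simps lookup_minus)
  then show ?thesis
    by (simp add: Nil)
next
  case (Cons y ys)
  have "Poly_Mapping.lookup (nc_var x * p) (Monomial xs)
      = Poly_Mapping.lookup (left_quotient y (nc_var x * p)) (Monomial ys)"
    by (simp only: Cons lookup_left_quotient)
  then show ?thesis
    by (simp add: Cons)
qed

text \<open>
  Write \<open>p = k + c p\<^sub>1 + d p\<^sub>2\<close> and let \<open>f\<close> be the substitution. Left quotients of \<open>f(p)\<close> by \<open>a\<close> and \<open>b\<close>
  are \<open>f(p\<^sub>1) + b f(p\<^sub>2)\<close> and \<open>f(p\<^sub>1) + a f(p\<^sub>2)\<close>, from which \<open>f(p\<^sub>2)\<close> and then \<open>f(p\<^sub>1)\<close> are obtained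
  by further quotients and differences; so divisibility passes from \<open>f(p)\<close> to \<open>f(p\<^sub>1)\<close> and \<open>f(p\<^sub>2)\<close>,
  and by induction on the word to the coefficients of \<open>p\<close>. The case \<open>m = 0\<close> says that \<open>f\<close> is
  injective, the case \<open>m = 2\<close> allows halving inside the image of \<open>f\<close>.
\<close>

lemma dvd_coeffs_cd_in_ab:
  fixes m :: int
  assumes "\<And>u. m dvd Poly_Mapping.lookup (nc_subst cd_in_ab p) u"
  shows "m dvd Poly_Mapping.lookup p (Monomial xs)"
  using assms
proof (induction xs arbitrary: p)
  case (Nil p)
  let ?f = "nc_subst cd_in_ab"
  let ?p1 = "left_quotient C_letter p" and ?p2 = "left_quotient D_letter p"
  have "?f p = of_int (Poly_Mapping.lookup p (Monomial []))
      + (nc_var A_letter * (?f ?p1 + nc_var B_letter * ?f ?p2)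
      + nc_var B_letter * (?f ?p1 + nc_var A_letter * ?f ?p2))"
    by (subst cd_decomposition) (simp add: nc_subst_add nc_subst_mult nc_subst_of_int algebra_simps)
  then have "Poly_Mapping.lookup (?f p) (Monomial []) = Poly_Mapping.lookup p (Monomial [])"
    by (simp add: lookup_add lookup_var_mult lookup_of_int zero_monomial_def)
  with Nil show ?case
    by metis
next
  case (Cons x xs p)
  let ?f = "nc_subst cd_in_ab"
  let ?p1 = "left_quotient C_letter p" and ?p2 = "left_quotient D_letter p"
  have fp: "?f p = of_int (Poly_Mapping.lookup p (Monomial []))
      + (nc_var A_letter * (?f ?p1 + nc_var B_letter * ?f ?p2)
      + nc_var B_letter * (?f ?p1 + nc_var A_letter * ?f ?p2))"
    by (subst cd_decomposition) (simp add: nc_subst_add nc_subst_mult nc_subst_of_int algebra_simps)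
  have A: "left_quotient A_letter (?f p) = ?f ?p1 + nc_var B_letter * ?f ?p2"
    and B: "left_quotient B_letter (?f p) = ?f ?p1 + nc_var A_letter * ?f ?p2"
    by (simp_all add: fp left_quotient_add)
  have D: "?f ?p2 = left_quotient B_letter (left_quotient A_letter (?f p))
      - left_quotient B_letter (left_quotient B_letter (?f p))"
    unfolding A B by (simp add: left_quotient_add)
  have lq: "m dvd Poly_Mapping.lookup (left_quotient y q) u"
    if "\<And>u. m dvd Poly_Mapping.lookup q u" for y u and q :: "ab ncpoly"
    by (metis that lookup_left_quotient monomial.exhaust)
  have dvd2: "m dvd Poly_Mapping.lookup (?f ?p2) u" for u
    unfolding D lookup_minus by (intro dvd_diff lq Cons.prems)
  have "m dvd Poly_Mapping.lookup (?f ?p1) u" for u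
  proof (cases u)
    case (Monomial w)
    have "m dvd Poly_Mapping.lookup (nc_var B_letter * ?f ?p2) u"
      using dvd2 by (auto simp: Monomial lookup_var_mult split: list.splits)
    moreover have "?f ?p1 = left_quotient A_letter (?f p) - nc_var B_letter * ?f ?p2"
      by (simp add: A)
    ultimately show ?thesis
      by (metis lookup_minus dvd_diff lq Cons.prems)
  qed
  then have "m dvd Poly_Mapping.lookup (left_quotient x p) (Monomial xs)"
    using Cons.IH[of "left_quotient x p"] dvd2 by (cases x) auto
  then show ?case
    by (simp add: lookup_left_quotient)
qed

lemma nc_subst_cd_inject:
  assumes "nc_subst cd_in_ab p = nc_subst cd_in_ab q"
  shows "p = q"
proof (rule poly_mapping_eqI)
  fix u :: "cd monomial"
  obtain xs where u: "u = Monomial xs" by (cases u)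
  have "0 dvd Poly_Mapping.lookup (p - q) (Monomial xs)"
    by (rule dvd_coeffs_cd_in_ab) (simp add: nc_subst_diff assms)
  then show "Poly_Mapping.lookup p u = Poly_Mapping.lookup q u"
    by (simp add: u lookup_minus)
qed

lemma half_in_cd_range:
  assumes "p + p = nc_subst cd_in_ab q"
  shows "\<exists>r. p = nc_subst cd_in_ab r"
proof -
  have dvd: "2 dvd Poly_Mapping.lookup q u" for u
  proof (cases u)
    case (Monomial xs)
    then show ?thesis
      using dvd_coeffs_cd_in_ab[of 2 q xs] by (simp add: lookup_add flip: assms)
  qed
  define r where "r = Poly_Mapping.map (\<lambda>k. k div 2) q"
  have "Poly_Mapping.lookup (r + r) u = Poly_Mapping.lookup q u" for u
    using dvd[of u] by (auto simp: r_def lookup_add Poly_Mapping.map.rep_eq when_def)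
  then have q: "q = r + r"
    by (metis poly_mapping_eqI)
  have "Poly_Mapping.lookup p u = Poly_Mapping.lookup (nc_subst cd_in_ab r) u" for u
    using arg_cong[OF assms, of "\<lambda>p. Poly_Mapping.lookup p u"]
    by (simp add: q nc_subst_add lookup_add)
  then show ?thesis
    by (metis poly_mapping_eqI)
qed

abbreviation (input) a_var :: "ab ncpoly" ("\<a>") where "\<a> \<equiv> nc_var A_letter"
abbreviation (input) b_var :: "ab ncpoly" ("\<b>") where "\<b> \<equiv> nc_var B_letter"
abbreviation (input) e_poly :: "ab ncpoly" ("\<e>") where "\<e> \<equiv> \<a> - \<b>"
abbreviation (input) c_poly :: "ab ncpoly" ("\<c>") where "\<c> \<equiv> \<a> + \<b>"
abbreviation (input) d_poly :: "ab ncpoly" ("\<d>") where "\<d> \<equiv> \<a> * \<b> + \<b> * \<a>"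

definition in_cd :: "ab ncpoly \<Rightarrow> bool" where
  "in_cd p \<longleftrightarrow> (\<exists>q. p = nc_subst cd_in_ab q)"

lemma in_cd_add: "in_cd p \<Longrightarrow> in_cd q \<Longrightarrow> in_cd (p + q)"
  and in_cd_diff: "in_cd p \<Longrightarrow> in_cd q \<Longrightarrow> in_cd (p - q)"
  and in_cd_mult: "in_cd p \<Longrightarrow> in_cd q \<Longrightarrow> in_cd (p * q)"
  by (auto simp: in_cd_def simp flip: nc_subst_add nc_subst_diff nc_subst_mult)

lemma in_cd_0: "in_cd 0" and in_cd_1: "in_cd 1"
  and in_cd_c: "in_cd \<c>" and in_cd_d: "in_cd \<d>"
  unfolding in_cd_def
  by (metis nc_subst_0, metis nc_subst_1, metis nc_subst_var cd_in_ab.simps(1),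
      metis nc_subst_var cd_in_ab.simps(2))

lemma in_cd_sum: "(\<And>x. x \<in> A \<Longrightarrow> in_cd (g x)) \<Longrightarrow> in_cd (sum g A)"
  by (induction A rule: infinite_finite_induct) (simp_all add: in_cd_0 in_cd_add)

text \<open>
  This rests on \<open>e\<^sup>2 = c\<^sup>2 - 2d\<close>.
\<close>

lemma in_cd_even_power:
  assumes "even k"
  shows "in_cd (\<e> ^ k)"
proof -
  have "\<e> ^ 2 = \<c> * \<c> - (\<d> + \<d>)"
    by (simp add: power2_eq_square algebra_simps)
  then have "in_cd (\<e> ^ 2)"
    by (simp only: in_cd_add in_cd_diff in_cd_mult in_cd_c in_cd_d)
  then have "in_cd ((\<e> ^ 2) ^ j)" for j
    by (induction j) (simp_all only: power_0 power_Suc in_cd_1 in_cd_mult)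
  then show ?thesis
    using assms by (auto elim!: evenE simp: power_mult)
qed

text \<open>
  With \<open>a \<mapsto> ab\<close>, \<open>b \<mapsto> ba\<close> the derivation sends \<open>c\<close> to \<open>d\<close> and \<open>d\<close> to \<open>dc\<close>, so it preserves the
  subring generated by \<open>c\<close> and \<open>d\<close>; on powers of \<open>e\<close> it is the commutator with \<open>a\<close>.
\<close>

definition ab_deriv :: "ab ncpoly \<Rightarrow> ab ncpoly" where
  "ab_deriv = nc_deriv (\<lambda>x. case x of A_letter \<Rightarrow> \<a> * \<b> | B_letter \<Rightarrow> \<b> * \<a>)"

definition cd_deriv :: "cd ncpoly \<Rightarrow> cd ncpoly" where
  "cd_deriv = nc_deriv (\<lambda>x. case x of C_letter \<Rightarrow> nc_var D_letter
     | D_letter \<Rightarrow> nc_var D_letter * nc_var C_letter)"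

lemma ab_deriv_cd_in_ab: "ab_deriv (nc_subst cd_in_ab p) = nc_subst cd_in_ab (cd_deriv p)"
  unfolding ab_deriv_def cd_deriv_def
proof (rule nc_deriv_subst)
  fix x :: cd
  show "nc_deriv (\<lambda>x. case x of A_letter \<Rightarrow> \<a> * \<b> | B_letter \<Rightarrow> \<b> * \<a>) (cd_in_ab x)
      = nc_subst cd_in_ab (case x of C_letter \<Rightarrow> nc_var D_letter
          | D_letter \<Rightarrow> nc_var D_letter * nc_var C_letter)"
    by (cases x) (simp_all add: nc_deriv_add nc_deriv_mult nc_subst_mult algebra_simps)
qed

lemma coeffs_nonneg_cd_deriv: "coeffs_nonneg p \<Longrightarrow> coeffs_nonneg (cd_deriv p)"
  unfolding cd_deriv_def
  by (rule coeffs_nonneg_deriv) (auto split: cd.splits intro: coeffs_nonneg_mult)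

lemma ab_deriv_simps:
  "ab_deriv \<a> = \<a> * \<b>" "ab_deriv \<b> = \<b> * \<a>" "ab_deriv 1 = 0"
  "ab_deriv (p + q) = ab_deriv p + ab_deriv q"
  "ab_deriv (p * q) = ab_deriv p * q + p * ab_deriv q"
  "ab_deriv (sum g A) = (\<Sum>x\<in>A. ab_deriv (g x))"
  by (simp_all add: ab_deriv_def nc_deriv_add nc_deriv_mult nc_deriv_sum)

lemma ab_deriv_e_power: "ab_deriv (\<e> ^ n) = \<e> ^ n * \<a> - \<a> * \<e> ^ n"
proof (induction n)
  case (Suc n)
  have "ab_deriv \<e> = \<e> * \<a> - \<a> * \<e>"
    unfolding ab_deriv_def nc_deriv_diff by (simp add: algebra_simps)
  then have "ab_deriv (\<e> ^ Suc n) = (\<e> * \<a> - \<a> * \<e>) * \<e> ^ n + \<e> * (\<e> ^ n * \<a> - \<a> * \<e> ^ n)"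
    by (simp only: power_Suc ab_deriv_simps Suc)
  moreover have "(e * a - a * e) * p + e * (p * a - a * p) = e * p * a - a * (e * p)"
    for e a p :: "ab ncpoly"
    by (simp add: algebra_simps)
  ultimately show ?case
    by (simp only: power_Suc)
qed (simp add: ab_deriv_simps)


section \<open>Flag vectors\<close>

text \<open>
  The monomial \<open>u\<^sub>R\<close> with every \<open>a\<close> replaced by \<open>e\<close>. This substitution is what inclusion-exclusion
  between the flag f-vector and the flag h-vector does to the generating polynomial.
\<close>

definition flag_product :: "nat \<Rightarrow> nat set \<Rightarrow> ab ncpoly" where
  "flag_product n R = prod_list (map (\<lambda>i. if i \<in> R then \<b> else \<e>) [1..<n + 1])"

lemma flag_product_0 [simp]: "flag_product 0 R = 1"
  by (simp add: flag_product_def)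

lemma flag_product_Suc:
  "flag_product (Suc n) R = flag_product n R * (if Suc n \<in> R then \<b> else \<e>)"
  by (simp add: flag_product_def)

lemma flag_product_empty: "flag_product n {} = \<e> ^ n"
  by (induction n) (simp_all add: flag_product_Suc power_commutes)

text \<open>
  If \<open>Suc k\<close> is the largest rank of a chain, everything after it is a power of \<open>e\<close>. This turns
  the choice of the largest element of a chain into the recursion for the ab-index.
\<close>

lemma flag_product_insert:
  assumes "R \<subseteq> {..k}" "k < n"
  shows "flag_product n (insert (Suc k) R) = flag_product k R * \<b> * \<e> ^ (n - Suc k)"
  using assms
proof (induction n)
  case (Suc n)
  show ?case
  proof (cases "k < n")
    case True
    then have "n - k = Suc (n - Suc k)" by simp
    with Suc True show ?thesis
      by (auto simp: flag_product_Suc power_commutes mult.assoc)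
  next
    case False
    with Suc.prems have [simp]: "n = k" by simp
    have "flag_product k (insert (Suc k) R) = flag_product k R"
      unfolding flag_product_def by (intro arg_cong[of _ _ prod_list] map_cong) auto
    then show ?thesis
      by (simp add: flag_product_Suc)
  qed
qed simp

text \<open>
  Expand every factor \<open>e = a - b\<close>: a subset \<open>T \<supseteq> R\<close> records the places at which a \<open>b\<close> is taken.
\<close>

lemma flag_product_expand:
  assumes "R \<subseteq> {1..n}"
  shows "flag_product n R =
    (\<Sum>T\<in>{T. R \<subseteq> T \<and> T \<subseteq> {1..n}}. of_int ((-1) ^ card (T - R)) * ab_monomial n T)"
  using assms
proof (induction n arbitrary: R)
  case 0
  then have "{T. R \<subseteq> T \<and> T \<subseteq> {1..0::nat}} = {{}}" "R = {}" by auto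
  then show ?case by (simp add: ab_monomial_def)
next
  case (Suc n)
  let ?m = "Suc n"
  have mono_Suc: "ab_monomial ?m T = ab_monomial n T * (if ?m \<in> T then \<b> else \<a>)" for T
    by (simp add: ab_monomial_def)
  have mono_insert: "ab_monomial n (insert ?m T) = ab_monomial n T" for T
    unfolding ab_monomial_def by (intro arg_cong[of _ _ prod_list] map_cong) auto
  define R' where "R' = R - {?m}"
  have R': "R' \<subseteq> {1..n}" using Suc.prems by (auto simp: R'_def atLeastAtMostSuc_conv)
  let ?U = "{T. R' \<subseteq> T \<and> T \<subseteq> {1..n}}"
  have finU: "finite ?U" by (rule finite_subset[of _ "Pow {1..n}"]) auto
  have inj: "inj_on (insert ?m) ?U"
  proof (rule inj_onI)
    fix T T' assume "T \<in> ?U" "T' \<in> ?U" "insert ?m T = insert ?m T'"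
    moreover from this have "?m \<notin> T" "?m \<notin> T'" by auto
    ultimately show "T = T'" by (metis Diff_insert_absorb)
  qed
  have fp: "flag_product n R = flag_product n R'"
    unfolding flag_product_def by (intro arg_cong[of _ _ prod_list] map_cong) (auto simp: R'_def)
  have notin: "?m \<notin> T" if "T \<in> ?U" for T using that by auto
  have finT: "finite T" if "T \<in> ?U" for T using that finite_subset by auto
  show ?case
  proof (cases "?m \<in> R")
    case True
    have *: "{T. R \<subseteq> T \<and> T \<subseteq> {1..?m}} = insert ?m ` ?U"
    proof (intro equalityI subsetI)
      fix T assume "T \<in> {T. R \<subseteq> T \<and> T \<subseteq> {1..?m}}"
      then have "T = insert ?m (T - {?m})" "T - {?m} \<in> ?U"
        using True by (auto simp: R'_def atLeastAtMostSuc_conv)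
      then show "T \<in> insert ?m ` ?U" by blast
    qed (use True in \<open>auto simp: R'_def atLeastAtMostSuc_conv\<close>)
    have D: "insert ?m T - R = T - R'" if "T \<in> ?U" for T
      using that True notin[OF that] by (auto simp: R'_def)
    have "flag_product ?m R = (\<Sum>T\<in>?U. of_int ((-1) ^ card (T - R')) * ab_monomial n T) * \<b>"
      using True by (simp only: flag_product_Suc fp Suc.IH[OF R'] if_True)
    also have "\<dots> = (\<Sum>T\<in>?U. of_int ((-1) ^ card (insert ?m T - R)) * ab_monomial ?m (insert ?m T))"
      unfolding sum_distrib_right
    proof (rule sum.cong[OF refl])
      fix T assume "T \<in> ?U"
      then show "of_int ((-1) ^ card (T - R')) * ab_monomial n T * \<b>
          = of_int ((-1) ^ card (insert ?m T - R)) * ab_monomial ?m (insert ?m T)"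
        by (simp only: D mono_Suc mono_insert insertI1 if_True mult.assoc)
    qed
    also have "\<dots> = (\<Sum>T\<in>{T. R \<subseteq> T \<and> T \<subseteq> {1..?m}}. of_int ((-1) ^ card (T - R)) * ab_monomial ?m T)"
      unfolding * by (simp only: sum.reindex[OF inj] o_def)
    finally show ?thesis .
  next
    case False
    then have RR: "R' = R" by (simp add: R'_def)
    have *: "{T. R \<subseteq> T \<and> T \<subseteq> {1..?m}} = ?U \<union> insert ?m ` ?U"
    proof (intro equalityI subsetI)
      fix T assume T: "T \<in> {T. R \<subseteq> T \<and> T \<subseteq> {1..?m}}"
      show "T \<in> ?U \<union> insert ?m ` ?U"
      proof (cases "?m \<in> T")
        case True
        with T False have "T = insert ?m (T - {?m})" "T - {?m} \<in> ?U"
          by (auto simp: R'_def atLeastAtMostSuc_conv)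
        then show ?thesis by blast
      qed (use T in \<open>auto simp: R'_def atLeastAtMostSuc_conv\<close>)
    qed (auto simp: RR)
    have disj: "?U \<inter> insert ?m ` ?U = {}" by auto
    have D: "card (insert ?m T - R) = Suc (card (T - R'))" if "T \<in> ?U" for T
    proof -
      have "insert ?m T - R = insert ?m (T - R')" using False RR by auto
      then show ?thesis using notin[OF that] finT[OF that] by simp
    qed
    have "(\<Sum>T\<in>{T. R \<subseteq> T \<and> T \<subseteq> {1..?m}}. of_int ((-1) ^ card (T - R)) * ab_monomial ?m T)
        = (\<Sum>T\<in>?U. of_int ((-1) ^ card (T - R)) * ab_monomial ?m T)
        + (\<Sum>T\<in>?U. of_int ((-1) ^ card (insert ?m T - R)) * ab_monomial ?m (insert ?m T))"
      unfolding * by (simp only: sum.union_disjoint[OF finU finite_imageI[OF finU] disj]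
          sum.reindex[OF inj] o_def)
    also have "\<dots> = (\<Sum>T\<in>?U. of_int ((-1) ^ card (T - R')) * ab_monomial n T * \<e>)"
      unfolding sum.distrib[symmetric]
    proof (rule sum.cong[OF refl])
      fix T assume T: "T \<in> ?U"
      show "of_int ((-1) ^ card (T - R)) * ab_monomial ?m T
          + of_int ((-1) ^ card (insert ?m T - R)) * ab_monomial ?m (insert ?m T)
          = of_int ((-1) ^ card (T - R')) * ab_monomial n T * \<e>"
        unfolding D[OF T] mono_Suc mono_insert RR using notin[OF T] by (simp add: algebra_simps)
    qed
    finally show ?thesis
      unfolding flag_product_Suc fp Suc.IH[OF R'] sum_distrib_right using False by simp
  qed
qed

lemma sum_flag_h_eq:
  "(\<Sum>T\<in>Pow {1..n}. of_int (flag_h P T) * ab_monomial n T)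
     = (\<Sum>R\<in>Pow {1..n}. of_nat (flag_f P R) * flag_product n R)"
proof -
  let ?g = "\<lambda>R T. of_nat (flag_f P R) * (of_int ((-1) ^ card (T - R)) * ab_monomial n T)"
  have "(\<Sum>T\<in>Pow {1..n}. of_int (flag_h P T) * ab_monomial n T)
      = (\<Sum>T\<in>Pow {1..n}. \<Sum>R\<in>{R \<in> Pow {1..n}. R \<subseteq> T}. ?g R T)"
  proof (intro sum.cong refl)
    fix T assume "T \<in> Pow {1..n}"
    then have eq: "{R \<in> Pow {1..n}. R \<subseteq> T} = Pow T" by auto
    have *: "of_int (i * int k) * p = of_nat k * (of_int i * p)" for i k and p :: "ab ncpoly"
      by (simp only: mult.commute[of i "int k"] of_int_mult of_int_of_nat_eq mult.assoc)
    show "of_int (flag_h P T) * ab_monomial n T = (\<Sum>R\<in>{R \<in> Pow {1..n}. R \<subseteq> T}. ?g R T)"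
      unfolding flag_h_def of_int_sum sum_distrib_right eq
      by (rule sum.cong[OF refl]) (rule *)
  qed
  also have "\<dots> = (\<Sum>R\<in>Pow {1..n}. \<Sum>T\<in>{T \<in> Pow {1..n}. R \<subseteq> T}. ?g R T)"
    by (rule sum.swap_restrict) auto
  also have "\<dots> = (\<Sum>R\<in>Pow {1..n}. of_nat (flag_f P R) * flag_product n R)"
  proof (intro sum.cong refl)
    fix R assume "R \<in> Pow {1..n}"
    moreover have "{T \<in> Pow {1..n}. R \<subseteq> T} = {T. R \<subseteq> T \<and> T \<subseteq> {1..n}}" by auto
    ultimately show "(\<Sum>T\<in>{T \<in> Pow {1..n}. R \<subseteq> T}. ?g R T) = of_nat (flag_f P R) * flag_product n R"
      by (simp add: flag_product_expand sum_distrib_left)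
  qed
  finally show ?thesis .
qed


section \<open>The ab-index of a poset with lifting involutions\<close>

text \<open>
  The elements of \<open>M\<close> are involutions which change the rank \<open>l\<close> by one and have the lifting
  property: if \<open>x\<close> and \<open>y\<close> are the lower elements of their orbits \<open>{x, s x}\<close> and \<open>{y, s y}\<close>, then
  \<open>x \<le> s y\<close>, \<open>x \<le> y\<close> and \<open>s x \<le> s y\<close> are equivalent. Every element of positive rank is the upper
  element of some orbit, which is the basis for induction on the rank.
\<close>

locale lifting_poset =
  fixes C :: "'p set" and le :: "'p \<Rightarrow> 'p \<Rightarrow> bool" and l :: "'p \<Rightarrow> nat" and M :: "('p \<Rightarrow> 'p) set"
  assumes le_refl: "x \<in> C \<Longrightarrow> le x x"
    and le_trans: "x \<in> C \<Longrightarrow> y \<in> C \<Longrightarrow> z \<in> C \<Longrightarrow> le x y \<Longrightarrow> le y z \<Longrightarrow> le x z"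
    and rank_mono: "x \<in> C \<Longrightarrow> y \<in> C \<Longrightarrow> le x y \<Longrightarrow> x \<noteq> y \<Longrightarrow> l x < l y"
    and finite_below: "y \<in> C \<Longrightarrow> finite {x \<in> C. le x y}"
    and inv_closed: "s \<in> M \<Longrightarrow> x \<in> C \<Longrightarrow> s x \<in> C"
    and inv_inv: "s \<in> M \<Longrightarrow> x \<in> C \<Longrightarrow> s (s x) = x"
    and inv_rank: "s \<in> M \<Longrightarrow> x \<in> C \<Longrightarrow> l (s x) = Suc (l x) \<or> l x = Suc (l (s x))"
    and inv_up: "s \<in> M \<Longrightarrow> x \<in> C \<Longrightarrow> l x < l (s x) \<Longrightarrow> le x (s x)"
    and lift_down: "s \<in> M \<Longrightarrow> x \<in> C \<Longrightarrow> y \<in> C \<Longrightarrow> l x < l (s x) \<Longrightarrow> l y < l (s y) \<Longrightarrow>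
      le x (s y) \<Longrightarrow> le x y"
    and lift_up: "s \<in> M \<Longrightarrow> x \<in> C \<Longrightarrow> y \<in> C \<Longrightarrow> l x < l (s x) \<Longrightarrow> l y < l (s y) \<Longrightarrow>
      le x y \<Longrightarrow> le (s x) (s y)"
    and descent_exists: "x \<in> C \<Longrightarrow> 0 < l x \<Longrightarrow> \<exists>s\<in>M. l (s x) < l x"
begin

definition lt :: "'p \<Rightarrow> 'p \<Rightarrow> bool" where
  "lt x y \<longleftrightarrow> le x y \<and> x \<noteq> y"

definition between :: "'p \<Rightarrow> 'p \<Rightarrow> 'p set" where
  "between u v = {x \<in> C. lt u x \<and> lt x v}"

definition chains :: "'p \<Rightarrow> 'p \<Rightarrow> 'p set set" where
  "chains u v = {X. X \<subseteq> between u v \<and> Complete_Partial_Order.chain le X}"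

text \<open>
  The chain form of the ab-index of the interval from \<open>u\<close> to \<open>v\<close>; that it is the ab-index uses
  gradedness and is shown later, in \<open>ab_index_interval\<close>.
\<close>

definition psi :: "'p \<Rightarrow> 'p \<Rightarrow> ab ncpoly" where
  "psi u v = (\<Sum>X\<in>chains u v. flag_product (l v - l u - 1) ((\<lambda>x. l x - l u) ` X))"

abbreviation ascends :: "('p \<Rightarrow> 'p) \<Rightarrow> 'p \<Rightarrow> bool" where
  "ascends s x \<equiv> l x < l (s x)"

lemma lt_rank: "x \<in> C \<Longrightarrow> y \<in> C \<Longrightarrow> lt x y \<Longrightarrow> l x < l y"
  using rank_mono by (auto simp: lt_def)

lemma le_antisym: "x \<in> C \<Longrightarrow> y \<in> C \<Longrightarrow> le x y \<Longrightarrow> le y x \<Longrightarrow> x = y"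
  using rank_mono[of x y] rank_mono[of y x] by fastforce

lemma le_lt_trans: "x \<in> C \<Longrightarrow> y \<in> C \<Longrightarrow> z \<in> C \<Longrightarrow> le x y \<Longrightarrow> lt y z \<Longrightarrow> lt x z"
  using le_trans[of x y z] le_antisym[of y z] by (auto simp: lt_def)

lemma lt_trans: "x \<in> C \<Longrightarrow> y \<in> C \<Longrightarrow> z \<in> C \<Longrightarrow> lt x y \<Longrightarrow> lt y z \<Longrightarrow> lt x z"
  using le_lt_trans by (auto simp: lt_def[of x y])

lemma between_carrier: "x \<in> between u v \<Longrightarrow> x \<in> C"
  by (simp add: between_def)

lemma finite_between [simp]: "v \<in> C \<Longrightarrow> finite (between u v)"
  by (rule finite_subset[OF _ finite_below[of v]]) (auto simp: between_def lt_def)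

lemma finite_chains [simp]: "v \<in> C \<Longrightarrow> finite (chains u v)"
  by (rule finite_subset[of _ "Pow (between u v)"]) (auto simp: chains_def)

lemma between_rank: "u \<in> C \<Longrightarrow> v \<in> C \<Longrightarrow> x \<in> between u v \<Longrightarrow> l u < l x \<and> l x < l v"
  by (auto simp: between_def lt_rank)

lemma not_ascends: "s \<in> M \<Longrightarrow> x \<in> C \<Longrightarrow> \<not> ascends s x \<longleftrightarrow> l x = Suc (l (s x))"
  using inv_rank[of s x] by auto

lemma ascends_rank: "s \<in> M \<Longrightarrow> x \<in> C \<Longrightarrow> ascends s x \<Longrightarrow> l (s x) = Suc (l x)"
  using inv_rank[of s x] by auto

lemma ascends_inv: "s \<in> M \<Longrightarrow> x \<in> C \<Longrightarrow> ascends s (s x) \<longleftrightarrow> \<not> ascends s x"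
  using inv_rank[of s x] inv_inv[of s x] by auto

lemma inv_lt: "s \<in> M \<Longrightarrow> x \<in> C \<Longrightarrow> ascends s x \<Longrightarrow> lt x (s x)"
  using inv_up by (auto simp: lt_def)

subsection \<open>The recursion for the ab-index\<close>

lemma chain_has_maximum:
  assumes "finite X" "X \<noteq> {}" "X \<subseteq> C" "Complete_Partial_Order.chain le X"
  shows "\<exists>m\<in>X. \<forall>x\<in>X. le x m"
proof -
  obtain m where m: "m \<in> X" "\<forall>x\<in>X. l x \<le> l m"
  proof -
    have "Max (l ` X) \<in> l ` X" using assms(1,2) by (intro Max_in) auto
    then obtain m where "m \<in> X" "l m = Max (l ` X)" by auto
    then show ?thesis using that assms(1) by simp
  qed
  have "le x m" if "x \<in> X" for x
  proof -
    have "le x m \<or> le m x"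
      using assms(4) that m(1) unfolding Complete_Partial_Order.chain_def by blast
    moreover have "x = m" if "le m x"
    proof (rule ccontr)
      assume "x \<noteq> m"
      then have "l m < l x" using rank_mono[of m x] m(1) \<open>x \<in> X\<close> that assms(3) by auto
      then show False using m(2) \<open>x \<in> X\<close> by auto
    qed
    ultimately show ?thesis
      using le_refl assms(3) that by auto
  qed
  then show ?thesis using m by blast
qed

lemma chains_decomposition:
  assumes "u \<in> C" "v \<in> C"
  shows "chains u v = insert {} ((\<lambda>(x, X). insert x X) ` (SIGMA x:between u v. chains u x))"
    (is "_ = insert {} ?I")
proof (intro equalityI subsetI)
  fix X assume X: "X \<in> chains u v"
  then have fin: "finite X" and sub: "X \<subseteq> between u v" and ch: "Complete_Partial_Order.chain le X"
    using finite_subset[OF _ finite_between[OF assms(2), of u]] by (auto simp: chains_def)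
  show "X \<in> insert {} ?I"
  proof (cases "X = {}")
    case False
    obtain m where m: "m \<in> X" "\<forall>x\<in>X. le x m"
      using chain_has_maximum[OF fin False _ ch] sub by (auto simp: between_def)
    have "X - {m} \<in> chains u m"
      using X m by (auto simp: chains_def between_def lt_def Complete_Partial_Order.chain_def)
    moreover have "X = insert m (X - {m})" "m \<in> between u v" using m sub by auto
    ultimately show ?thesis by blast
  qed simp
next
  fix X assume "X \<in> insert {} ?I"
  then consider "X = {}" | x Y where "X = insert x Y" "x \<in> between u v" "Y \<in> chains u x"
    by auto
  then show "X \<in> chains u v"
  proof cases
    case 2
    have xC: "x \<in> C" using 2 by (auto simp: between_def)
    have "Y \<subseteq> between u v"
      using 2 assms xC by (auto simp: chains_def between_def intro: lt_trans)
    moreover have "Complete_Partial_Order.chain le X"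
      using 2 xC le_refl[of x] unfolding chains_def Complete_Partial_Order.chain_def between_def lt_def
      by blast
    ultimately show ?thesis
      using 2 by (auto simp: chains_def)
  qed (auto simp: chains_def Complete_Partial_Order.chain_def)
qed

text \<open>
  Sort the chains by their largest element. In matrix form, with \<open>Z(u,v) = e\<^bsup>l v - l u - 1\<^esup>\<close> for
  \<open>u < v\<close>, this is \<open>\<Psi> = Z + \<Psi> b Z\<close>.
\<close>

lemma psi_rec:
  assumes "u \<in> C" "v \<in> C"
  shows "psi u v = \<e> ^ (l v - l u - 1) + (\<Sum>x\<in>between u v. psi u x * \<b> * \<e> ^ (l v - l x - 1))"
proof -
  let ?n = "l v - l u - 1" and ?r = "\<lambda>X. (\<lambda>x. l x - l u) ` X"
  let ?S = "SIGMA x:between u v. chains u x" and ?i = "\<lambda>(x, X). insert x X"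
  have maxX: "x \<notin> X \<and> (\<forall>y\<in>X. l y < l x)" if "(x, X) \<in> ?S" for x X
    using that between_rank[of u x] assms by (auto simp: chains_def between_def lt_def lt_rank)
  have inj: "inj_on ?i ?S"
  proof (rule inj_onI)
    fix p q assume pq: "p \<in> ?S" "q \<in> ?S" "?i p = ?i q"
    obtain x X y Y where [simp]: "p = (x, X)" "q = (y, Y)" by (cases p, cases q) auto
    have eq: "insert x X = insert y Y" and max: "x \<notin> X" "\<forall>z\<in>X. l z < l x" "y \<notin> Y" "\<forall>z\<in>Y. l z < l y"
      using pq(3) maxX[of x X] maxX[of y Y] pq(1,2) by auto
    have "x \<in> insert y Y" "y \<in> insert x X" using eq by blast+
    then have "x = y"
      using max by fastforce
    moreover have "insert x X - {x} = X" "insert y Y - {y} = Y"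
      using max by blast+
    ultimately show "p = q"
      using eq by auto
  qed
  have finS: "finite ?S"
    using assms by (intro finite_SigmaI finite_chains) (simp_all add: between_carrier)
  have "psi u v = flag_product ?n (?r {}) + (\<Sum>X\<in>?i ` ?S. flag_product ?n (?r X))"
    unfolding psi_def chains_decomposition[OF assms] using finS
    by (subst sum.insert) auto
  also have "(\<Sum>X\<in>?i ` ?S. flag_product ?n (?r X)) = (\<Sum>(x, X)\<in>?S. flag_product ?n (?r (insert x X)))"
    unfolding sum.reindex[OF inj] by (simp add: case_prod_beta' o_def)
  also have "\<dots> = (\<Sum>x\<in>between u v. \<Sum>X\<in>chains u x. flag_product ?n (?r (insert x X)))"
    by (rule sum.Sigma[symmetric]) (use assms in \<open>auto dest: between_carrier\<close>)
  also have "\<dots> = (\<Sum>x\<in>between u v. psi u x * \<b> * \<e> ^ (l v - l x - 1))"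
    unfolding psi_def sum_distrib_right
  proof (intro sum.cong refl)
    fix x X assume x: "x \<in> between u v" and X: "X \<in> chains u x"
    have r: "l u < l x" "l x < l v" using between_rank[OF assms x] by auto
    let ?k = "l x - l u - 1"
    \<comment> \<open>The rank of \<open>x\<close> in the interval is \<open>Suc k\<close>, as \<open>flag_product_insert\<close> requires.\<close>
    have rx: "?r (insert x X) = insert (Suc ?k) (?r X)" using r by auto
    have rX: "?r X \<subseteq> {..?k}"
    proof
      fix i assume "i \<in> ?r X"
      then obtain y where "y \<in> X" "i = l y - l u" by auto
      moreover from this have "l y < l x" using maxX x X by blast
      ultimately show "i \<in> {..?k}" by auto
    qed
    have kn: "?k < ?n" "?n - Suc ?k = l v - l x - 1" using r by auto
    show "flag_product ?n (?r (insert x X))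
        = flag_product ?k (?r X) * \<b> * \<e> ^ (l v - l x - 1)"
      unfolding rx flag_product_insert[OF rX kn(1)] kn(2) ..
  qed
  finally show ?thesis
    by (simp add: flag_product_empty)
qed

lemma psi_cover: "u \<in> C \<Longrightarrow> v \<in> C \<Longrightarrow> l v = Suc (l u) \<Longrightarrow> psi u v = 1"
proof -
  assume *: "u \<in> C" "v \<in> C" "l v = Suc (l u)"
  then have "between u v = {}" using between_rank[of u v] by fastforce
  with * show ?thesis by (subst psi_rec) simp_all
qed

text \<open>
  Associativity of the product in the incidence algebra.
\<close>

lemma sum_between_swap:
  assumes "u \<in> C" "v \<in> C"
  shows "(\<Sum>x\<in>between u v. \<Sum>y\<in>between u x. F y x) = (\<Sum>y\<in>between u v. \<Sum>x\<in>between y v. F y x)"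
proof -
  have "(\<Sum>x\<in>between u v. \<Sum>y\<in>between u x. F y x)
      = (\<Sum>x\<in>between u v. \<Sum>y\<in>{y \<in> between u v. lt y x}. F y x)"
    using assms by (intro sum.cong) (auto simp: between_def intro: lt_trans)
  also have "\<dots> = (\<Sum>y\<in>between u v. \<Sum>x\<in>{x \<in> between u v. lt y x}. F y x)"
    using assms by (intro sum.swap_restrict) auto
  also have "\<dots> = (\<Sum>y\<in>between u v. \<Sum>x\<in>between y v. F y x)"
    using assms by (intro sum.cong) (auto simp: between_def intro: lt_trans)
  finally show ?thesis .
qed

end


section \<open>Eulerian intervals\<close>

context lifting_poset
begin

definition ivl :: "'p \<Rightarrow> 'p \<Rightarrow> 'p set" where
  "ivl u v = {x \<in> C. le u x \<and> le x v}"

lemma finite_ivl [simp]: "v \<in> C \<Longrightarrow> finite (ivl u v)"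
  by (rule finite_subset[OF _ finite_below[of v]]) (auto simp: ivl_def)

lemma ivl_eq: "u \<in> C \<Longrightarrow> v \<in> C \<Longrightarrow> lt u v \<Longrightarrow> ivl u v = insert u (insert v (between u v))"
  using le_refl by (auto simp: ivl_def between_def lt_def)

lemma le_iff_of_ascends:
  assumes "s \<in> M" "w \<in> C" "ascends s w" "x \<in> C" "ascends s x"
  shows "le x (s w) \<longleftrightarrow> le x w" "le (s x) (s w) \<longleftrightarrow> le x w"
proof -
  have cl: "s x \<in> C" "s w \<in> C" using assms inv_closed by auto
  show 1: "le x (s w) \<longleftrightarrow> le x w"
    using lift_down[of s x w] le_trans[of x w "s w"] inv_up[of s w] assms cl by blast
  show "le (s x) (s w) \<longleftrightarrow> le x w"
    using lift_up[of s x w] le_trans[of x "s x" "s w"] inv_up[of s x] 1 assms cl by blast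
qed

text \<open>
  If \<open>s\<close> raises \<open>u\<close> and lowers the top element, it permutes the interval and reverses all signs.
\<close>

lemma eulerian_involution:
  assumes "s \<in> M" "u \<in> C" "w \<in> C" "ascends s u" "ascends s w"
  shows "(\<Sum>x\<in>ivl u (s w). (-1) ^ l x) = (0 :: int)"
proof -
  let ?I = "ivl u (s w)"
  have cl: "s w \<in> C" using assms inv_closed by auto
  have sI: "s x \<in> ?I" if x: "x \<in> ?I" for x
  proof -
    have xC: "x \<in> C" "s x \<in> C" "le u x" "le x (s w)"
      using x assms inv_closed[of s x] by (auto simp: ivl_def)
    show ?thesis
    proof (cases "ascends s x")
      case True
      then have "le (s x) (s w)" using le_iff_of_ascends[of s w x] assms xC by auto
      moreover have "le u (s x)" using le_trans[of u x "s x"] inv_up[of s x] True xC assms by auto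
      ultimately show ?thesis using xC by (simp add: ivl_def)
    next
      case False
      then have a: "ascends s (s x)" using ascends_inv assms xC by auto
      have "le (s x) x" using inv_up[of s "s x"] a inv_inv[of s x] assms xC by auto
      then have "le (s x) (s w)" using le_trans[of "s x" x "s w"] xC cl by auto
      moreover have "le u (s x)"
        using lift_down[of s u "s x"] a inv_inv[of s x] assms xC by auto
      ultimately show ?thesis using xC by (simp add: ivl_def)
    qed
  qed
  have ss: "s (s x) = x" if "x \<in> ?I" for x using that assms inv_inv by (auto simp: ivl_def)
  have "(\<Sum>x\<in>?I. (-1) ^ l x) = (\<Sum>x\<in>?I. (-1) ^ l (s x) :: int)"
    by (rule sum.reindex_bij_witness[where i = s and j = s]) (use sI ss in auto)
  also have "\<dots> = (\<Sum>x\<in>?I. - ((-1) ^ l x))"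
  proof (rule sum.cong[OF refl])
    fix x assume "x \<in> ?I"
    then show "(-1) ^ l (s x) = - ((-1) ^ l x :: int)"
      using inv_rank[of s x] assms(1) by (auto simp: ivl_def)
  qed
  finally show ?thesis
    by (simp add: sum_negf)
qed

text \<open>
  Let \<open>v = s w\<close> with \<open>w\<close> the lower element. If \<open>s\<close> raises \<open>u\<close> the involution cancels all terms. Otherwise
  let \<open>u = s u'\<close>. Split each of the sums over \<open>[u,v]\<close>, \<open>[u',v]\<close>, \<open>[u,w]\<close>, \<open>[u',w]\<close> into lower and upper
  elements. By the lifting property the lower part does not depend on the choice between \<open>v\<close> and \<open>w\<close>, and
  the upper part not on the choice between \<open>u\<close> and \<open>u'\<close>. The last three sums vanish: the one over
  \<open>[u',v]\<close> by the involution, the other two by induction or because \<open>[u,w]\<close> is empty. Hence so does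
  the first.
\<close>

lemma eulerian:
  assumes "u \<in> C" "v \<in> C" "lt u v"
  shows "(\<Sum>x\<in>ivl u v. (-1) ^ l x) = (0 :: int)"
  using assms
proof (induction "l v" arbitrary: u v rule: less_induct)
  case less
  note uv = less.prems
  obtain s where s: "s \<in> M" "l (s v) < l v"
    using descent_exists[of v] lt_rank[OF uv] uv by auto
  define w where "w = s v"
  have w: "w \<in> C" "s w = v" "ascends s w" "l w < l v"
    using s uv inv_closed[of s v] inv_inv[of s v] by (auto simp: w_def)
  show ?case
  proof (cases "ascends s u")
    case True
    then show ?thesis using eulerian_involution[of s u w] s uv w by simp
  next
    case False
    define u' where "u' = s u"
    have u': "u' \<in> C" "s u' = u" "ascends s u'"
      using s uv inv_closed[of s u] inv_inv[of s u] False ascends_inv[of s u] by (auto simp: u'_def)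
    define SA where "SA x y = (\<Sum>z\<in>{z \<in> ivl x y. ascends s z}. (-1) ^ l z :: int)" for x y
    define SD where "SD x y = (\<Sum>z\<in>{z \<in> ivl x y. \<not> ascends s z}. (-1) ^ l z :: int)" for x y
    have split: "(\<Sum>z\<in>ivl x y. (-1) ^ l z) = SA x y + SD x y" if "y \<in> C" for x y
      unfolding SA_def SD_def using that
      by (subst sum.union_disjoint[symmetric]) (auto intro: sum.cong)
    have SA: "SA x v = SA x w" for x
      unfolding SA_def ivl_def using le_iff_of_ascends(1)[of s w] s w by (intro sum.cong) auto
    have SD: "SD u y = SD u' y" if "y \<in> C" for y
    proof -
      have "le u z \<longleftrightarrow> le u' z" if z: "z \<in> C" "\<not> ascends s z" for z
      proof -
        have sz: "s z \<in> C" "ascends s (s z)" "s (s z) = z"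
          using z s inv_closed[of s z] inv_inv[of s z] ascends_inv[of s z] by auto
        then show ?thesis
          using le_iff_of_ascends[of s "s z" u'] s u' by simp
      qed
      then show ?thesis unfolding SD_def ivl_def by (intro sum.cong) auto
    qed
    have 1: "SA u' v + SD u' v = 0"
      using eulerian_involution[of s u' w] split[of v u'] s u' w uv by simp
    have 2: "SA u w + SD u w = 0"
    proof (cases "le u w")
      case True
      then have "lt u w" using False w by (auto simp: lt_def)
      then show ?thesis using less.hyps[of w u] split[of w u] uv w by simp
    next
      case False
      then have "ivl u w = {}"
        using le_trans[of u _ w] uv w by (auto simp: ivl_def)
      then show ?thesis using split[of w u] w by simp
    qed
    have "le u' w"
      using le_iff_of_ascends(2)[of s w u'] s u' w uv by (auto simp: lt_def)
    moreover have "u' \<noteq> w" using u' w uv by (auto simp: lt_def)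
    ultimately have 3: "SA u' w + SD u' w = 0"
      using less.hyps[of w u'] split[of w u'] u' w by (simp add: lt_def)
    show ?thesis
      using 1 2 3 split[of v u] SA[of u] SA[of u'] SD[of v] SD[of w] uv w by simp
  qed
qed

lemma eulerian_between:
  assumes "u \<in> C" "v \<in> C" "lt u v"
  shows "(\<Sum>x\<in>between u v. (-1) ^ (l v - l x - 1)) = (1 - (-1) ^ (l v - l u - 1) :: int)"
proof -
  \<comment> \<open>Truncated subtraction is harmless here, as \<open>l x < l v\<close>.\<close>
  have "(-1) ^ (l v - l x - 1) = - ((-1) ^ l v * (-1) ^ l x :: int)" if "l x < l v" for x
  proof -
    obtain k where k: "l v = l x + k + 1"
      using \<open>l x < l v\<close> by (metis add.assoc add.commute less_iff_Suc_add Suc_eq_plus1)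
    have "(-1) ^ l x * (-1) ^ l x = (1 :: int)"
      by (simp flip: power_add)
    then show ?thesis
      unfolding k by (simp add: power_add)
  qed note * = this
  have "(\<Sum>x\<in>between u v. (-1) ^ (l v - l x - 1)) = (\<Sum>x\<in>between u v. - ((-1) ^ l v * (-1) ^ l x :: int))"
    using between_rank[OF assms(1,2)] * by (intro sum.cong) auto
  also have "\<dots> = - ((-1) ^ l v * (\<Sum>x\<in>between u v. (-1) ^ l x))"
    by (simp add: sum_negf sum_distrib_left)
  also have "(\<Sum>x\<in>between u v. (-1) ^ l x) = (- ((-1) ^ l u) - (-1) ^ l v :: int)"
  proof -
    have "u \<notin> insert v (between u v)" "v \<notin> between u v"
      using assms by (auto simp: between_def lt_def)
    then show ?thesis
      using eulerian[OF assms] assms by (simp add: ivl_eq)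
  qed
  also have "- ((-1) ^ l v * (- ((-1) ^ l u) - (-1) ^ l v)) = (1 - (-1) ^ (l v - l u - 1) :: int)"
  proof -
    have "(-1) ^ l v * (-1) ^ l v = (1 :: int)"
      by (simp flip: power_add)
    then show ?thesis
      using *[of u] lt_rank[OF assms] by (simp add: algebra_simps)
  qed
  finally show ?thesis .
qed

text \<open>
  Let \<open>Z'\<close> arise from \<open>Z\<close> by exchanging \<open>a\<close> and \<open>b\<close>, that is, \<open>e\<close> and \<open>-e\<close>. The Eulerian property
  says that \<open>1 + e Z\<close> and \<open>1 - e Z'\<close> are inverse to each other, that is, \<open>Z e Z' = Z - Z'\<close>.
\<close>

lemma zeta_relation:
  assumes "u \<in> C" "v \<in> C" "lt u v"
  shows "(\<Sum>x\<in>between u v. \<e> ^ (l x - l u - 1) * \<e> * (- \<e>) ^ (l v - l x - 1))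
    = \<e> ^ (l v - l u - 1) - (- \<e>) ^ (l v - l u - 1)"
proof -
  let ?n = "l v - l u - 1"
  have "(\<Sum>x\<in>between u v. \<e> ^ (l x - l u - 1) * \<e> * (- \<e>) ^ (l v - l x - 1))
      = (\<Sum>x\<in>between u v. \<e> ^ ?n * of_int ((-1) ^ (l v - l x - 1)))"
  proof (rule sum.cong[OF refl])
    fix x assume "x \<in> between u v"
    then have r: "l u < l x" "l x < l v" using between_rank assms by auto
    then have "?n = (l x - l u - 1) + 1 + (l v - l x - 1)" by simp
    then have "\<e> ^ ?n = \<e> ^ (l x - l u - 1) * \<e> * \<e> ^ (l v - l x - 1)"
      by (simp only: power_add power_one_right)
    moreover have "(- \<e>) ^ (l v - l x - 1) = \<e> ^ (l v - l x - 1) * of_int ((-1) ^ (l v - l x - 1))"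
      by (cases "even (l v - l x - 1)") (simp_all del: minus_diff_eq)
    ultimately show "\<e> ^ (l x - l u - 1) * \<e> * (- \<e>) ^ (l v - l x - 1)
        = \<e> ^ ?n * of_int ((-1) ^ (l v - l x - 1))"
      by (simp only: mult.assoc)
  qed
  also have "\<dots> = \<e> ^ ?n * of_int (1 - (-1) ^ ?n)"
    by (simp only: eulerian_between[OF assms, symmetric] of_int_sum sum_distrib_left)
  also have "\<dots> = \<e> ^ ?n - (- \<e>) ^ ?n"
    by (cases "even ?n") (simp_all add: mult_2_right del: minus_diff_eq)
  finally show ?thesis .
qed

text \<open>
  The recursion for \<open>\<Psi>\<close> is invariant under exchanging \<open>a\<close> and \<open>b\<close>. In matrix form, with
  \<open>\<Psi> b Z = \<Psi> - Z\<close> and \<open>Z e Z' = Z - Z'\<close>: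
  \<open>\<Psi> b Z' = \<Psi> b Z - \<Psi> b Z e Z' = (\<Psi> - Z) - (\<Psi> - Z) e Z' = \<Psi> - Z' - \<Psi> e Z'\<close>,
  and \<open>b + e = a\<close>.
\<close>

lemma psi_rec_swapped:
  assumes "u \<in> C" "v \<in> C" "lt u v"
  shows "psi u v = (- \<e>) ^ (l v - l u - 1)
    + (\<Sum>x\<in>between u v. psi u x * \<a> * (- \<e>) ^ (l v - l x - 1))"
proof -
  let ?Z = "\<lambda>x y. \<e> ^ (l y - l x - 1)" and ?Z' = "\<lambda>x y. (- \<e>) ^ (l y - l x - 1)"
  let ?B = "between u v"
  have xC: "x \<in> C" "lt x v" "lt u x" if "x \<in> ?B" for x using that by (auto simp: between_def)
  have "(\<Sum>x\<in>?B. psi u x * \<b> * ?Z' x v)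
      = (\<Sum>x\<in>?B. psi u x * \<b> * ?Z x v) - (\<Sum>x\<in>?B. \<Sum>y\<in>between x v. psi u x * \<b> * ?Z x y * \<e> * ?Z' y v)"
    unfolding sum_subtractf[symmetric]
  proof (rule sum.cong[OF refl])
    fix x assume "x \<in> ?B"
    then have "?Z' x v = ?Z x v - (\<Sum>y\<in>between x v. ?Z x y * \<e> * ?Z' y v)"
      using zeta_relation[of x v] xC assms by simp
    moreover have "p * (z - (\<Sum>y\<in>A. f y * e * g y)) = p * z - (\<Sum>y\<in>A. p * f y * e * g y)"
      for p z e :: "ab ncpoly" and f g :: "'p \<Rightarrow> ab ncpoly" and A
      by (simp only: right_diff_distrib sum_distrib_left mult.assoc)
    ultimately show "psi u x * \<b> * ?Z' x v
        = psi u x * \<b> * ?Z x v - (\<Sum>y\<in>between x v. psi u x * \<b> * ?Z x y * \<e> * ?Z' y v)"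
      by (simp only:)
  qed
  also have "(\<Sum>x\<in>?B. \<Sum>y\<in>between x v. psi u x * \<b> * ?Z x y * \<e> * ?Z' y v)
      = (\<Sum>y\<in>?B. \<Sum>x\<in>between u y. psi u x * \<b> * ?Z x y * \<e> * ?Z' y v)"
    by (rule sum_between_swap[OF assms(1,2), symmetric])
  also have "\<dots> = (\<Sum>y\<in>?B. psi u y * \<e> * ?Z' y v - ?Z u y * \<e> * ?Z' y v)"
  proof (rule sum.cong[OF refl])
    fix y assume "y \<in> ?B"
    then have "(\<Sum>x\<in>between u y. psi u x * \<b> * ?Z x y) = psi u y - ?Z u y"
      using psi_rec[of u y] xC assms by simp
    moreover have "(\<Sum>x\<in>A. f x) * e * z = q * e * z - r * e * z" if "(\<Sum>x\<in>A. f x) = q - r"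
      for q r e z :: "ab ncpoly" and f :: "'p \<Rightarrow> ab ncpoly" and A
      using that by (simp only: left_diff_distrib)
    ultimately show "(\<Sum>x\<in>between u y. psi u x * \<b> * ?Z x y * \<e> * ?Z' y v)
        = psi u y * \<e> * ?Z' y v - ?Z u y * \<e> * ?Z' y v"
      by (simp only: sum_distrib_right[symmetric])
  qed
  also have "\<dots> = (\<Sum>y\<in>?B. psi u y * \<e> * ?Z' y v) - (?Z u v - ?Z' u v)"
    by (simp only: sum_subtractf zeta_relation[OF assms])
  also have "(\<Sum>x\<in>?B. psi u x * \<b> * ?Z x v) = psi u v - ?Z u v"
    using psi_rec[OF assms(1,2)] by simp
  finally have "(\<Sum>x\<in>?B. psi u x * \<b> * ?Z' x v) + (\<Sum>y\<in>?B. psi u y * \<e> * ?Z' y v) = psi u v - ?Z' u v"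
    by (simp del: minus_diff_eq)
  moreover have "(\<Sum>x\<in>?B. psi u x * \<b> * ?Z' x v) + (\<Sum>y\<in>?B. psi u y * \<e> * ?Z' y v)
      = (\<Sum>x\<in>?B. psi u x * \<a> * ?Z' x v)"
  proof -
    have "p * \<b> * q + p * \<e> * q = p * \<a> * q" for p q
      by (simp add: algebra_simps)
    then show ?thesis by (simp only: sum.distrib[symmetric])
  qed
  ultimately have "psi u v - ?Z' u v = (\<Sum>x\<in>?B. psi u x * \<a> * ?Z' x v)"
    by (simp only:)
  then show ?thesis
    by (simp only: diff_eq_eq add.commute)
qed

text \<open>
  Adding the two recursions gives \<open>2 \<Psi> = (Z + Z') + \<Psi> (b Z + a Z')\<close>. If \<open>k\<close> is the exponent in an entry
  of \<open>Z\<close>, the entries of \<open>Z + Z'\<close> are \<open>2 e\<^sup>k\<close> for even \<open>k\<close> and \<open>0\<close> for odd \<open>k\<close>; those of \<open>b Z + a Z'\<close> are \<open>c e\<^sup>k\<close> for even \<open>k\<close> and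
  \<open>-e\<^bsup>k+1\<^esup>\<close> for odd \<open>k\<close>. All of these are polynomials in \<open>c\<close> and \<open>d\<close>, and halving stays inside
  the subring.
\<close>

lemma psi_in_cd:
  assumes "u \<in> C" "v \<in> C" "lt u v"
  shows "in_cd (psi u v)"
  using assms(2,3)
proof (induction "l v" arbitrary: v rule: less_induct)
  case less
  let ?B = "between u v"
  have "psi u v + psi u v = (\<e> ^ (l v - l u - 1) + (- \<e>) ^ (l v - l u - 1))
      + (\<Sum>x\<in>?B. psi u x * (\<b> * \<e> ^ (l v - l x - 1) + \<a> * (- \<e>) ^ (l v - l x - 1)))"
    (is "_ = ?p + ?q")
    using psi_rec[OF assms(1) less.prems(1)] psi_rec_swapped[OF assms(1) less.prems]
    by (simp add: distrib_left sum.distrib mult.assoc del: minus_diff_eq)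
  moreover have "in_cd ?p"
  proof (cases "even (l v - l u - 1)")
    case True
    then show ?thesis by (auto simp: in_cd_even_power in_cd_add simp del: minus_diff_eq)
  next
    case False
    then show ?thesis by (simp add: in_cd_0 del: minus_diff_eq)
  qed
  moreover have "in_cd ?q"
  proof (rule in_cd_sum, rule in_cd_mult)
    fix x assume x: "x \<in> ?B"
    then show "in_cd (psi u x)"
      using less between_rank[OF assms(1) less.prems(1) x] by (auto simp: between_def)
    let ?k = "l v - l x - 1"
    show "in_cd (\<b> * \<e> ^ ?k + \<a> * (- \<e>) ^ ?k)"
    proof (cases "even ?k")
      case True
      then have "\<b> * \<e> ^ ?k + \<a> * (- \<e>) ^ ?k = \<c> * \<e> ^ ?k"
        by (simp add: distrib_right del: minus_diff_eq)
      then show ?thesis using True by (simp only: in_cd_mult in_cd_c in_cd_even_power)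
    next
      case False
      then have "\<b> * \<e> ^ ?k + \<a> * (- \<e>) ^ ?k = 0 - \<e> ^ Suc ?k"
        by (simp add: left_diff_distrib del: minus_diff_eq)
      then show ?thesis using False by (simp only: in_cd_diff in_cd_0 in_cd_even_power even_Suc not_False_eq_True)
    qed
  qed
  ultimately have "in_cd (psi u v + psi u v)"
    by (simp only: in_cd_add)
  then show ?case
    using half_in_cd_range by (auto simp: in_cd_def)
qed

end


section \<open>Gradedness and the cd-index of an interval\<close>

context lifting_poset
begin

text \<open>
  Modulo the commutator with \<open>a\<close>, the derivation kills \<open>e\<close> and sends \<open>b\<close> to \<open>ab\<close>. Applied to the
  recursion, it therefore cuts each chain at one of its elements \<open>x\<close> and replaces the \<open>b\<close> there by
  \<open>ab\<close>, so that the sum over the chains through \<open>x\<close> becomes \<open>\<Psi>[u,x] ab \<Psi>[x,v]\<close>.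
\<close>

lemma ab_deriv_psi:
  assumes "u \<in> C" "v \<in> C"
  shows "ab_deriv (psi u v) =
    (\<Sum>x\<in>between u v. psi u x * (\<a> * \<b>) * psi x v) + psi u v * \<a> - \<a> * psi u v"
  using assms(2)
proof (induction "l v" arbitrary: v rule: less_induct)
  case less
  let ?B = "between u v" and ?E = "\<lambda>x. \<e> ^ (l v - l x - 1)"
  let ?K = "\<lambda>y. \<Sum>x\<in>between u y. psi u x * (\<a> * \<b>) * psi x y"
  have step: "ab_deriv (psi u x * \<b> * ?E x)
      = ?K x * \<b> * ?E x + psi u x * (\<a> * \<b>) * ?E x + psi u x * \<b> * ?E x * \<a> - \<a> * (psi u x * \<b> * ?E x)"
    if x: "x \<in> ?B" for x
  proof -
    have "ab_deriv (psi u x) = ?K x + psi u x * \<a> - \<a> * psi u x"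
      using less.hyps[of x] x between_rank[OF assms(1) less.prems x] by (simp add: between_def)
    then have "ab_deriv (psi u x * \<b> * ?E x)
        = ((?K x + psi u x * \<a> - \<a> * psi u x) * \<b> + psi u x * (\<b> * \<a>)) * ?E x
          + psi u x * \<b> * (?E x * \<a> - \<a> * ?E x)"
      by (simp only: ab_deriv_simps ab_deriv_e_power)
    moreover have "((k + p * a - a * p) * b + p * (b * a)) * e + p * b * (e * a - a * e)
        = k * b * e + p * (a * b) * e + p * b * e * a - a * (p * b * e)" for k p a b e :: "ab ncpoly"
      by (simp add: algebra_simps)
    ultimately show ?thesis by (simp only:)
  qed
  have "?K v = (\<Sum>x\<in>?B. psi u x * (\<a> * \<b>) * ?E x)
      + (\<Sum>x\<in>?B. \<Sum>y\<in>between x v. psi u x * (\<a> * \<b>) * (psi x y * \<b> * ?E y))"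
    unfolding sum.distrib[symmetric]
  proof (rule sum.cong[OF refl])
    fix x assume "x \<in> ?B"
    then show "psi u x * (\<a> * \<b>) * psi x v = psi u x * (\<a> * \<b>) * ?E x
        + (\<Sum>y\<in>between x v. psi u x * (\<a> * \<b>) * (psi x y * \<b> * ?E y))"
      by (subst psi_rec[of x v]) (simp_all only: less.prems between_carrier distrib_left sum_distrib_left)
  qed
  also have "(\<Sum>x\<in>?B. \<Sum>y\<in>between x v. psi u x * (\<a> * \<b>) * (psi x y * \<b> * ?E y))
      = (\<Sum>y\<in>?B. ?K y * \<b> * ?E y)"
    unfolding sum_between_swap[OF assms(1) less.prems, symmetric] sum_distrib_right
    by (simp only: mult.assoc)
  finally have K: "?K v = (\<Sum>x\<in>?B. psi u x * (\<a> * \<b>) * ?E x) + (\<Sum>y\<in>?B. ?K y * \<b> * ?E y)" .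
  let ?Q = "\<Sum>x\<in>?B. psi u x * \<b> * ?E x"
  have psi: "psi u v = \<e> ^ (l v - l u - 1) + ?Q"
    by (rule psi_rec[OF assms(1) less.prems])
  have "ab_deriv (psi u v) = ab_deriv (\<e> ^ (l v - l u - 1)) + (\<Sum>x\<in>?B. ab_deriv (psi u x * \<b> * ?E x))"
    by (simp only: psi ab_deriv_simps(4,6))
  also have "(\<Sum>x\<in>?B. ab_deriv (psi u x * \<b> * ?E x)) = ?K v + ?Q * \<a> - \<a> * ?Q"
  proof -
    have "(\<Sum>x\<in>A. f x + g x + h x * a - a * h x) = (sum g A + sum f A) + sum h A * a - a * sum h A"
      for f g h :: "'p \<Rightarrow> ab ncpoly" and A a
      by (simp add: sum.distrib sum_subtractf sum_distrib_left sum_distrib_right)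
    note gen = this
    show ?thesis
      unfolding K by (rule trans[OF sum.cong[OF refl step] gen])
  qed
  finally show ?case
    unfolding ab_deriv_e_power
    unfolding psi by (simp only: distrib_left distrib_right) simp
qed

text \<open>
  Let \<open>v = s w\<close> with \<open>w\<close> the lower element. Either \<open>u \<le> w\<close>, or \<open>u = s u'\<close> is an upper element with
  \<open>u' < w\<close>; then an element \<open>x\<close> of corank one in \<open>[u',w]\<close> is a lower element unless \<open>u \<le> x\<close>,
  and is lifted to \<open>s x\<close> in \<open>[u,v]\<close>.
\<close>

lemma exists_cover:
  assumes "u \<in> C" "v \<in> C" "lt u v"
  shows "\<exists>x\<in>C. le u x \<and> lt x v \<and> l v = Suc (l x)"
  using assms
proof (induction "l v" arbitrary: u v rule: less_induct)
  case less
  note uv = less.prems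
  obtain s where s: "s \<in> M" "l (s v) < l v"
    using descent_exists[of v] lt_rank[OF uv] uv by auto
  define w where "w = s v"
  have w: "w \<in> C" "s w = v" "ascends s w" "l v = Suc (l w)" "lt w v"
    using s uv inv_closed[of s v] inv_inv[of s v] ascends_rank[of s w] inv_lt[of s w]
    by (auto simp: w_def)
  show ?case
  proof (cases "le u w")
    case False
    then have "\<not> ascends s u"
      using le_iff_of_ascends(1)[of s w u] s w uv by (auto simp: lt_def)
    define u' where "u' = s u"
    have u': "u' \<in> C" "s u' = u" "ascends s u'" "l u = Suc (l u')"
      using \<open>\<not> ascends s u\<close> s uv inv_closed[of s u] inv_inv[of s u] ascends_inv[of s u] not_ascends[of s u]
      by (auto simp: u'_def)
    have "le u' w" using le_iff_of_ascends(2)[of s w u'] u' s w uv by (auto simp: lt_def)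
    moreover have "u' \<noteq> w" using u' w uv by (auto simp: lt_def)
    ultimately obtain x where x: "x \<in> C" "le u' x" "lt x w" "l w = Suc (l x)"
      using less.hyps[of w u'] u' w by (auto simp: lt_def)
    show ?thesis
    proof (cases "ascends s x")
      case True
      have "le u (s x)" using lift_up[of s u' x] True x u' s by auto
      moreover have "lt (s x) v"
        using lift_up[of s x w] True x w s ascends_rank[of s x] by (auto simp: lt_def)
      ultimately show ?thesis
        using inv_closed[of s x] ascends_rank[of s x] True x w s by auto
    next
      case False
      then have sx: "s x \<in> C" "ascends s (s x)" "s (s x) = x"
        using s x inv_closed[of s x] ascends_inv[of s x] inv_inv[of s x] by auto
      then have "le u x"
        using le_iff_of_ascends[of s "s x" u'] x u' s by auto
      then have "le u w" using le_trans[of u x w] x w uv by (auto simp: lt_def)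
      with \<open>\<not> le u w\<close> show ?thesis ..
    qed
  qed (use w in blast)
qed

lemma saturated_chain:
  assumes "u \<in> C" "v \<in> C" "le u v"
  shows "\<exists>X. X \<subseteq> {y \<in> C. le u y \<and> lt y v} \<and> Complete_Partial_Order.chain le X \<and> card X = l v - l u"
  using assms(2,3)
proof (induction "l v" arbitrary: v rule: less_induct)
  case (less v)
  show ?case
  proof (cases "u = v")
    case True
    then show ?thesis
      by (intro exI[of _ "{}"]) (simp add: Complete_Partial_Order.chain_def)
  next
    case False
    then obtain x where x: "x \<in> C" "le u x" "lt x v" "l v = Suc (l x)"
      using exists_cover[of u v] less.prems assms(1) by (auto simp: lt_def)
    then obtain X where X: "X \<subseteq> {y \<in> C. le u y \<and> lt y x}" "Complete_Partial_Order.chain le X"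
        "card X = l x - l u"
      using less.hyps[of x] by auto
    have "finite X"
      by (rule finite_subset[OF _ finite_below[of x]]) (use X x in \<open>auto simp: lt_def\<close>)
    moreover have "x \<notin> X" using X by (auto simp: lt_def)
    moreover have "l u \<le> l x" using rank_mono[of u x] x assms(1) by fastforce
    ultimately have "card (insert x X) = l v - l u" using X x by simp
    moreover have "insert x X \<subseteq> {y \<in> C. le u y \<and> lt y v}"
      using X x lt_trans[of _ x v] less.prems by blast
    moreover have "Complete_Partial_Order.chain le (insert x X)"
      using X x le_refl[of x] unfolding Complete_Partial_Order.chain_def lt_def by blast
    ultimately show ?thesis by blast
  qed
qed

lemma card_chain_le:
  assumes "u \<in> C" "v \<in> C" "X \<subseteq> {y \<in> C. le u y \<and> lt y v}" "Complete_Partial_Order.chain le X"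
  shows "card X \<le> l v - l u"
proof -
  have inj: "inj_on l X"
  proof (rule inj_onI)
    fix x y assume xy: "x \<in> X" "y \<in> X" "l x = l y"
    then have "le x y \<or> le y x" using assms(4) unfolding Complete_Partial_Order.chain_def by blast
    then show "x = y" using rank_mono[of x y] rank_mono[of y x] xy assms(3) by fastforce
  qed
  have "l ` X \<subseteq> {l u..<l v}"
  proof
    fix i assume "i \<in> l ` X"
    then obtain x where x: "i = l x" "x \<in> C" "le u x" "lt x v" using assms(3) by auto
    then show "i \<in> {l u..<l v}"
      using rank_mono[of u x] lt_rank[of x v] assms(1,2) by fastforce
  qed
  then have "card (l ` X) \<le> l v - l u"
    using card_mono[of "{l u..<l v}"] by fastforce
  then show ?thesis using card_image[OF inj] by simp
qed

abbreviation interval :: "'p \<Rightarrow> 'p \<Rightarrow> 'p gorder" where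
  "interval u v \<equiv> interval_poset \<lparr>carrier = C, eq = (=), le = le\<rparr> u v"

lemma carrier_interval: "carrier (interval u v) = {x \<in> C. le u x \<and> le x v}"
  and le_interval: "gorder.le (interval u v) = le"
  and lless_interval: "x \<sqsubset>\<^bsub>interval u v\<^esub> y \<longleftrightarrow> lt x y"
  by (auto simp: interval_poset_def at_least_at_most_def lless_def lt_def)

lemma poset_rank_interval:
  assumes "u \<in> C" "x \<in> C" "v \<in> C" "le u x" "le x v"
  shows "poset_rank (interval u v) x = l x - l u"
proof -
  have eq: "{y \<in> carrier (interval u v). y \<sqsubset>\<^bsub>interval u v\<^esub> x} = {y \<in> C. le u y \<and> lt y x}"
    unfolding carrier_interval lless_interval
    using le_trans[of _ x v] assms by (auto simp: lt_def)
  let ?D = "{X. X \<subseteq> {y \<in> C. le u y \<and> lt y x} \<and> Complete_Partial_Order.chain le X}"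
  have fin: "finite ?D"
    by (rule finite_subset[of _ "Pow {y \<in> C. le y x}"])
       (use finite_below[OF assms(2)] in \<open>auto simp: lt_def\<close>)
  obtain X where X: "X \<in> ?D" "card X = l x - l u"
    using saturated_chain[OF assms(1,2,4)] by blast
  have "Max (card ` ?D) = l x - l u"
  proof (rule Max_eqI)
    show "l x - l u \<in> card ` ?D" using imageI[OF X(1), of card] X(2) by (simp only:)
    show "k \<le> l x - l u" if k: "k \<in> card ` ?D" for k
    proof -
      obtain Y where "Y \<in> ?D" "k = card Y" using k by (rule imageE)
      then show ?thesis using card_chain_le[OF assms(1,2), of Y] by simp
    qed
  qed (use fin in simp)
  then show ?thesis
    unfolding poset_rank_def eq le_interval .
qed

lemma bottom_interval:
  assumes "u \<in> C" "v \<in> C" "le u v"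
  shows "\<bottom>\<^bsub>interval u v\<^esub> = u"
proof -
  have "least (interval u v) x (carrier (interval u v)) \<longleftrightarrow> x = u" for x
    unfolding least_def carrier_interval le_interval
    using assms le_refl[of u] le_antisym[of x u] by auto
  then show ?thesis by (simp add: bottom_def)
qed

lemma top_interval:
  assumes "u \<in> C" "v \<in> C" "le u v"
  shows "\<top>\<^bsub>interval u v\<^esub> = v"
proof -
  have "greatest (interval u v) x (carrier (interval u v)) \<longleftrightarrow> x = v" for x
    unfolding greatest_def carrier_interval le_interval
    using assms le_refl[of v] le_antisym[of x v] by auto
  then show ?thesis by (simp add: top_def)
qed

text \<open>
  By gradedness the rank of an element of the interval is its \<open>l\<close>-difference to \<open>u\<close>, so the flag
  f-vector counts the chains that occur in \<open>psi\<close> by their sets of ranks.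
\<close>

lemma ab_index_interval:
  assumes "u \<in> C" "v \<in> C" "lt u v"
  shows "ab_index (interval u v) = psi u v"
proof -
  let ?P = "interval u v" and ?n = "l v - l u - 1" and ?r = "\<lambda>X. (\<lambda>x. l x - l u) ` X"
  have uv: "le u v" using assms by (simp add: lt_def)
  have rank_top: "poset_rank ?P \<top>\<^bsub>?P\<^esub> - 1 = ?n"
    using poset_rank_interval[of u v v] top_interval le_refl[of v] uv assms by simp
  have open_eq: "carrier ?P - {\<bottom>\<^bsub>?P\<^esub>, \<top>\<^bsub>?P\<^esub>} = between u v"
    unfolding carrier_interval bottom_interval[OF assms(1,2) uv] top_interval[OF assms(1,2) uv]
    by (auto simp: between_def lt_def)
  have ranks: "poset_rank ?P ` X = ?r X" if "X \<subseteq> between u v" for X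
    using that assms by (intro image_cong refl) (auto intro!: poset_rank_interval simp: between_def lt_def)
  have flag: "flag_f ?P R = card {X \<in> chains u v. ?r X = R}" for R
    unfolding flag_f_def open_eq le_interval using ranks
    by (intro arg_cong[of _ _ card]) (auto simp: chains_def)
  have sub: "?r ` chains u v \<subseteq> Pow {1..?n}"
  proof
    fix R assume "R \<in> ?r ` chains u v"
    then obtain X where X: "R = ?r X" "X \<subseteq> between u v" by (auto simp: chains_def)
    have "l x - l u \<in> {1..?n}" if "x \<in> X" for x
    proof -
      have "x \<in> between u v" using that X(2) by blast
      then show ?thesis using between_rank[OF assms(1,2), of x] by auto
    qed
    then show "R \<in> Pow {1..?n}" using X by auto
  qed
  have "ab_index ?P = (\<Sum>R\<in>Pow {1..?n}. of_nat (flag_f ?P R) * flag_product ?n R)"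
    unfolding ab_index_def rank_top Let_def by (rule sum_flag_h_eq)
  also have "\<dots> = (\<Sum>R\<in>Pow {1..?n}. \<Sum>X\<in>{X \<in> chains u v. ?r X = R}. flag_product ?n (?r X))"
    unfolding flag by (intro sum.cong refl) simp
  also have "\<dots> = psi u v"
    unfolding psi_def using assms sub by (intro sum.group) auto
  finally show ?thesis .
qed

definition phi :: "'p \<Rightarrow> 'p \<Rightarrow> cd ncpoly" where
  "phi u v = cd_index (interval u v)"

lemma nc_subst_phi:
  assumes "u \<in> C" "v \<in> C" "lt u v"
  shows "nc_subst cd_in_ab (phi u v) = psi u v"
proof -
  obtain q where q: "psi u v = nc_subst cd_in_ab q"
    using psi_in_cd[OF assms] by (auto simp: in_cd_def)
  have "cd_index (interval u v) = q"
    unfolding cd_index_def ab_index_interval[OF assms] q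
    by (rule the_equality) (auto intro: nc_subst_cd_inject)
  then show ?thesis by (simp add: phi_def q)
qed

end


section \<open>The cd-index along a lifting involution\<close>

context lifting_poset
begin

definition twist :: "('p \<Rightarrow> 'p) \<Rightarrow> 'p \<Rightarrow> ab ncpoly" where
  "twist s v = (if ascends s v then \<a> * \<b> else - (\<b> * \<a>))"

text \<open>
  For \<open>y\<close> raised by \<open>s\<close> this is the candidate for \<open>\<Psi>[u, s y]\<close>. It is defined for all \<open>y\<close>,
  since the recursion for it runs through elements of both kinds.
\<close>

definition lifted :: "('p \<Rightarrow> 'p) \<Rightarrow> 'p \<Rightarrow> 'p \<Rightarrow> ab ncpoly" where
  "lifted s u y = \<b> * psi u y + psi u y * \<a> + (\<Sum>v\<in>between u y. psi u v * twist s v * psi v y)"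

text \<open>
  Apply the recursion for \<open>\<Psi>\<close> to both the first term and the right factors of the sum; the
  inner sums are the ones that define \<open>lifted\<close> at \<open>x\<close>.
\<close>

lemma lifted_rec:
  assumes "u \<in> C" "y \<in> C"
  shows "lifted s u y = \<b> * \<e> ^ (l y - l u - 1) + psi u y * \<a> +
    (\<Sum>x\<in>between u y. ((lifted s u x - psi u x * \<a>) * \<b> + psi u x * twist s x) * \<e> ^ (l y - l x - 1))"
proof -
  let ?B = "between u y" and ?E = "\<lambda>x. \<e> ^ (l y - l x - 1)"
  let ?K = "\<lambda>y. \<Sum>x\<in>between u y. psi u x * twist s x * psi x y"
  have "?K y = (\<Sum>x\<in>?B. psi u x * twist s x * ?E x)
      + (\<Sum>x\<in>?B. \<Sum>z\<in>between x y. psi u x * twist s x * (psi x z * \<b> * ?E z))"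
    unfolding sum.distrib[symmetric]
  proof (rule sum.cong[OF refl])
    fix x assume "x \<in> ?B"
    then show "psi u x * twist s x * psi x y = psi u x * twist s x * ?E x
        + (\<Sum>z\<in>between x y. psi u x * twist s x * (psi x z * \<b> * ?E z))"
      by (subst psi_rec[of x y]) (simp_all only: assms between_carrier distrib_left sum_distrib_left)
  qed
  also have "(\<Sum>x\<in>?B. \<Sum>z\<in>between x y. psi u x * twist s x * (psi x z * \<b> * ?E z))
      = (\<Sum>z\<in>?B. ?K z * \<b> * ?E z)"
    unfolding sum_between_swap[OF assms, symmetric] sum_distrib_right
    by (simp only: mult.assoc)
  finally have K: "?K y = (\<Sum>x\<in>?B. psi u x * twist s x * ?E x) + (\<Sum>x\<in>?B. ?K x * \<b> * ?E x)" .
  have "\<b> * psi u y = \<b> * ?E u + (\<Sum>x\<in>?B. \<b> * psi u x * \<b> * ?E x)"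
    by (subst psi_rec[OF assms]) (simp only: distrib_left sum_distrib_left mult.assoc)
  then have "lifted s u y = \<b> * ?E u + (\<Sum>x\<in>?B. \<b> * psi u x * \<b> * ?E x) + psi u y * \<a>
      + ((\<Sum>x\<in>?B. psi u x * twist s x * ?E x) + (\<Sum>x\<in>?B. ?K x * \<b> * ?E x))"
    by (simp only: lifted_def K)
  also have "\<dots> = \<b> * ?E u + psi u y * \<a>
      + (\<Sum>x\<in>?B. \<b> * psi u x * \<b> * ?E x + psi u x * twist s x * ?E x + ?K x * \<b> * ?E x)"
    by (simp only: sum.distrib ac_simps)
  also have "(\<Sum>x\<in>?B. \<b> * psi u x * \<b> * ?E x + psi u x * twist s x * ?E x + ?K x * \<b> * ?E x)
      = (\<Sum>x\<in>?B. ((lifted s u x - psi u x * \<a>) * \<b> + psi u x * twist s x) * ?E x)"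
  proof (rule sum.cong[OF refl])
    fix x
    have "b * p * b * e + p * t * e + k * b * e = ((b * p + p * a + k - p * a) * b + p * t) * e"
      for a b e k p t :: "ab ncpoly"
      by (simp add: algebra_simps)
    then show "\<b> * psi u x * \<b> * ?E x + psi u x * twist s x * ?E x + ?K x * \<b> * ?E x
        = ((lifted s u x - psi u x * \<a>) * \<b> + psi u x * twist s x) * ?E x"
      by (simp only: lifted_def)
  qed
  finally show ?thesis .
qed

text \<open>
  Let \<open>N\<close> be the set of lower elements strictly between \<open>u\<close> and \<open>w\<close>. By the lifting property, \<open>s\<close>
  matches the lower elements from \<open>u\<close> up to \<open>w\<close>, that is \<open>u\<close>, \<open>N\<close> and \<open>w\<close>, with the upper elements from
  \<open>s u\<close> up to \<open>s w\<close>; the open interval from \<open>u\<close> to \<open>s w\<close> misses \<open>u\<close> and \<open>s w\<close>.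
\<close>

lemma
  assumes "s \<in> M" "u \<in> C" "w \<in> C" "ascends s u" "ascends s w" "lt u w"
  shows ascents_between_inv: "{x \<in> between u (s w). ascends s x} = insert w {x \<in> between u w. ascends s x}"
    and descents_between_inv: "{x \<in> between u (s w). \<not> ascends s x} = s ` insert u {x \<in> between u w. ascends s x}"
proof -
  have sw: "s w \<in> C" "lt w (s w)" using assms inv_closed inv_lt by auto
  show "{x \<in> between u (s w). ascends s x} = insert w {x \<in> between u w. ascends s x}"
    using le_iff_of_ascends(1)[of s w] lt_trans[of _ w "s w"] sw assms
    by (auto simp: between_def lt_def)
  show "{x \<in> between u (s w). \<not> ascends s x} = s ` insert u {x \<in> between u w. ascends s x}"
  proof (intro equalityI subsetI)
    fix x assume "x \<in> {x \<in> between u (s w). \<not> ascends s x}"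
    then have x: "x \<in> C" "lt u x" "lt x (s w)" "\<not> ascends s x" by (auto simp: between_def)
    then have z: "s x \<in> C" "ascends s (s x)" "s (s x) = x"
      using assms inv_closed[of s x] inv_inv[of s x] ascends_inv[of s x] by auto
    have "le u (s x)" using le_iff_of_ascends(1)[of s "s x" u] x z assms by (auto simp: lt_def)
    moreover have "le (s x) w" using le_iff_of_ascends(2)[of s w "s x"] x z assms by (auto simp: lt_def)
    moreover have "s x \<noteq> w" using x z by (auto simp: lt_def)
    ultimately have "s x \<in> insert u {x \<in> between u w. ascends s x}"
      using z by (auto simp: between_def lt_def)
    then show "x \<in> s ` insert u {x \<in> between u w. ascends s x}"
      by (rule image_eqI[of x s "s x", OF z(3)[symmetric]])
  next
    fix x assume "x \<in> s ` insert u {x \<in> between u w. ascends s x}"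
    then obtain z where z: "x = s z" "z \<in> C" "le u z" "lt z w" "ascends s z"
      using assms le_refl[of u] by (auto simp: between_def lt_def)
    have sz: "s z \<in> C" "lt z (s z)" "\<not> ascends s (s z)"
      using z assms inv_closed[of s z] inv_lt[of s z] ascends_inv[of s z] by auto
    have "lt u (s z)" using le_lt_trans[of u z "s z"] z sz assms by auto
    moreover have "le (s z) (s w)" using lift_up[of s z w] z assms by (auto simp: lt_def)
    moreover have "s z \<noteq> s w" using inv_inv[of s z] inv_inv[of s w] z assms by (auto simp: lt_def)
    ultimately show "x \<in> {x \<in> between u (s w). \<not> ascends s x}"
      using z(1) sz by (simp add: between_def lt_def)
  qed
qed

lemma sum_between_split:
  assumes "y \<in> C"
  shows "(\<Sum>x\<in>between u y. f x)
    = (\<Sum>x\<in>{x \<in> between u y. ascends s x}. f x) + (\<Sum>x\<in>{x \<in> between u y. \<not> ascends s x}. f x)"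
proof -
  have "between u y = {x \<in> between u y. ascends s x} \<union> {x \<in> between u y. \<not> ascends s x}" by auto
  then have "(\<Sum>x\<in>between u y. f x)
      = (\<Sum>x\<in>{x \<in> between u y. ascends s x} \<union> {x \<in> between u y. \<not> ascends s x}. f x)" by simp
  also have "\<dots> = (\<Sum>x\<in>{x \<in> between u y. ascends s x}. f x) + (\<Sum>x\<in>{x \<in> between u y. \<not> ascends s x}. f x)"
    using assms by (intro sum.union_disjoint) auto
  finally show ?thesis .
qed

lemma sum_descents_between_inv:
  assumes "s \<in> M" "u \<in> C" "w \<in> C" "ascends s u" "ascends s w" "lt u w"
  shows "(\<Sum>x\<in>{x \<in> between u (s w). \<not> ascends s x}. f x)
    = f (s u) + (\<Sum>x\<in>{x \<in> between u w. ascends s x}. f (s x))"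
proof -
  let ?N = "{x \<in> between u w. ascends s x}"
  have "inj_on s (insert u ?N)"
  proof (rule inj_onI)
    fix x y assume xy: "x \<in> insert u ?N" "y \<in> insert u ?N" "s x = s y"
    then have "x \<in> C" "y \<in> C" using assms by (auto simp: between_def)
    then show "x = y"
      using arg_cong[OF xy(3), of s] assms(1) by (simp only: inv_inv)
  qed
  moreover have "u \<notin> ?N" by (auto simp: between_def lt_def)
  moreover have "finite ?N" using assms by simp
  ultimately show ?thesis
    unfolding descents_between_inv[OF assms] by (simp add: sum.reindex)
qed

lemma sum_ascents_between_inv:
  assumes "s \<in> M" "u \<in> C" "w \<in> C" "ascends s u" "ascends s w" "lt u w"
  shows "(\<Sum>x\<in>{x \<in> between u (s w). ascends s x}. f x)
    = f w + (\<Sum>x\<in>{x \<in> between u w. ascends s x}. f x)"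
proof -
  have "w \<notin> {x \<in> between u w. ascends s x}" by (auto simp: between_def lt_def)
  moreover have "finite {x \<in> between u w. ascends s x}" using assms by simp
  ultimately show ?thesis
    unfolding ascents_between_inv[OF assms] by simp
qed

text \<open>
  By induction each summand of the recursion for \<open>lifted\<close> becomes \<open>\<Psi>[u, s x] b e\<^sup>k\<close> for a lower
  element \<open>x\<close>, and \<open>-\<Psi>[u,x] b e\<^bsup>k+1\<^esup>\<close> for an upper one; the latter because
  \<open>\<Psi> (c b - ab - ba) = -\<Psi> b e\<close>.

  If \<open>y\<close> is a lower element, compare with the recursion for \<open>\<Psi>[u, s y]\<close>: up to sign, the
  two differ by \<open>\<Psi>[u,y] e\<close> minus its own recursion, that is, by zero. If \<open>y = s w\<close> is an upper element, then the
  lower elements other than \<open>w\<close> and the upper elements other than \<open>s u\<close> cancel in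
  pairs \<open>{x, s x}\<close>, and the two exceptions contribute \<open>\<Psi>[u,y] b\<close> and \<open>-b e\<^sup>n\<close>, where
  \<open>n = l y - l u - 1\<close>. If \<open>w = u\<close>, there are no elements in between and these two terms cancel.
\<close>

lemma lifted_eq:
  assumes "s \<in> M" "u \<in> C" "ascends s u" "y \<in> C" "lt u y"
  shows "lifted s u y = (if ascends s y then psi u (s y) else psi u y * \<c>)"
  using assms(4,5)
proof (induction "l y" arbitrary: y rule: less_induct)
  case less
  note y = less.prems
  let ?B = "between u y"
  let ?A = "{x \<in> ?B. ascends s x}" and ?D = "{x \<in> ?B. \<not> ascends s x}"
  let ?E = "\<lambda>x. \<e> ^ (l y - l x - 1)"
  have su: "s u \<in> C" "psi u (s u) = 1" "l (s u) = Suc (l u)"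
    using inv_closed[of s u] psi_cover[of u "s u"] ascends_rank[of s u] assms by auto
  have summand: "((lifted s u x - psi u x * \<a>) * \<b> + psi u x * twist s x) * ?E x
      = (if ascends s x then psi u (s x) * \<b> * ?E x else - (psi u x * \<b> * (?E x * \<e>)))"
    if x: "x \<in> ?B" for x
  proof -
    have IH: "lifted s u x = (if ascends s x then psi u (s x) else psi u x * \<c>)"
      using less.hyps[of x] x between_rank[OF assms(2) y(1) x] by (simp add: between_def)
    show ?thesis
    proof (cases "ascends s x")
      case True
      have "((q - p * a) * b + p * (a * b)) * e = q * b * e" for p q a b e :: "ab ncpoly"
        by (simp add: algebra_simps)
      with True show ?thesis by (simp only: IH twist_def if_True)
    next
      case False
      have "((p * (a + b) - p * a) * b + p * (- (b * a))) * f = - (p * b * ((a - b) * f))"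
        for p a b f :: "ab ncpoly"
        by (simp add: algebra_simps)
      with False show ?thesis by (simp only: IH twist_def if_False power_commutes)
    qed
  qed
  have h: "lifted s u y = \<b> * ?E u + psi u y * \<a>
      + ((\<Sum>x\<in>?A. psi u (s x) * \<b> * ?E x) - (\<Sum>x\<in>?D. psi u x * \<b> * (?E x * \<e>)))"
  proof -
    have "(\<Sum>x\<in>?B. ((lifted s u x - psi u x * \<a>) * \<b> + psi u x * twist s x) * ?E x)
        = (\<Sum>x\<in>?B. if ascends s x then psi u (s x) * \<b> * ?E x else - (psi u x * \<b> * (?E x * \<e>)))"
      by (rule sum.cong[OF refl summand])
    also have "\<dots> = (\<Sum>x\<in>?A. psi u (s x) * \<b> * ?E x) + (\<Sum>x\<in>?D. - (psi u x * \<b> * (?E x * \<e>)))"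
      unfolding sum_between_split[OF y(1), of _ u s] by simp
    finally have "(\<Sum>x\<in>?B. ((lifted s u x - psi u x * \<a>) * \<b> + psi u x * twist s x) * ?E x)
        = (\<Sum>x\<in>?A. psi u (s x) * \<b> * ?E x) + (\<Sum>x\<in>?D. - (psi u x * \<b> * (?E x * \<e>)))" .
    then show ?thesis
      by (simp only: lifted_rec[OF assms(2) y(1), of s] sum_negf add_uminus_conv_diff)
  qed
  show ?case
  proof (cases "ascends s y")
    case True
    have sy: "s y \<in> C" "l (s y) = Suc (l y)"
      using inv_closed[of s y] ascends_rank[of s y] True y assms by auto
    let ?E' = "\<lambda>x. \<e> ^ (l (s y) - l x - 1)"
    have E': "?E' x = ?E x * \<e>" if "l x < l y" for x
    proof -
      have "l (s y) - l x - 1 = Suc (l y - l x - 1)" using that sy by simp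
      then show ?thesis by (simp only: power_Suc2)
    qed
    have "psi u (s y) = ?E' u + ((psi u y * \<b> * ?E' y + (\<Sum>x\<in>?A. psi u x * \<b> * ?E' x))
        + (psi u (s u) * \<b> * ?E' (s u) + (\<Sum>x\<in>?A. psi u (s x) * \<b> * ?E' (s x))))"
      using psi_rec[OF assms(2) sy(1)]
      by (simp only: sum_between_split[OF sy(1), of _ u s]
          sum_ascents_between_inv[OF assms(1,2) y(1) assms(3) True y(2)]
          sum_descents_between_inv[OF assms(1,2) y(1) assms(3) True y(2)])
    moreover have "?E' u = ?E u * \<e>" using E' lt_rank[OF assms(2) y] by simp
    moreover have "?E' y = 1" "?E' (s u) = ?E u" using sy su by simp_all
    moreover have "(\<Sum>x\<in>?A. psi u x * \<b> * ?E' x) = (\<Sum>x\<in>?A. psi u x * \<b> * (?E x * \<e>))"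
      using between_rank[OF assms(2) y(1)] E' by (intro sum.cong refl) simp
    moreover have "(\<Sum>x\<in>?A. psi u (s x) * \<b> * ?E' (s x)) = (\<Sum>x\<in>?A. psi u (s x) * \<b> * ?E x)"
      using ascends_rank assms(1) sy by (intro sum.cong refl) (auto simp: between_def)
    ultimately have psi_sy: "psi u (s y) = ?E u * \<e>
        + ((psi u y * \<b> * 1 + (\<Sum>x\<in>?A. psi u x * \<b> * (?E x * \<e>)))
        + (1 * \<b> * ?E u + (\<Sum>x\<in>?A. psi u (s x) * \<b> * ?E x)))"
      by (simp only: su(2))
    have "psi u y * \<e> = ?E u * \<e> + (\<Sum>x\<in>?B. psi u x * \<b> * (?E x * \<e>))"
      by (subst psi_rec[OF assms(2) y(1)]) (simp only: distrib_right sum_distrib_right mult.assoc)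
    then have psi_e: "psi u y * \<e> = ?E u * \<e> + ((\<Sum>x\<in>?A. psi u x * \<b> * (?E x * \<e>))
        + (\<Sum>x\<in>?D. psi u x * \<b> * (?E x * \<e>)))"
      unfolding sum_between_split[OF y(1), of _ u s] .
    have "r = b * z + p * a + (q - t)"
      if "r = f + ((p * b * 1 + q') + (1 * b * z + q))" "p * (a - b) = f + (q' + t)"
      for a b f p q q' r t z :: "ab ncpoly"
    proof -
      have "p * a = p * b + (f + (q' + t))" using that(2) by (simp add: algebra_simps)
      then show ?thesis using that(1) by (simp add: algebra_simps)
    qed
    from this[OF psi_sy psi_e] True show ?thesis
      by (simp only: h if_True)
  next
    case False
    define w where "w = s y"
    have w: "w \<in> C" "s w = y" "ascends s w" "l y = Suc (l w)"
      using inv_closed[of s y] inv_inv[of s y] ascends_inv[of s y] not_ascends[of s y] False y assms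
      by (auto simp: w_def)
    have "(\<Sum>x\<in>?A. psi u (s x) * \<b> * ?E x) - (\<Sum>x\<in>?D. psi u x * \<b> * (?E x * \<e>))
        = psi u y * \<b> - \<b> * ?E u"
    proof (cases "w = u")
      case True
      \<comment> \<open>Here \<open>y = s u\<close> covers \<open>u\<close>.\<close>
      then have "?B = {}" using between_rank[OF assms(2) y(1)] w by fastforce
      moreover have "psi u y = 1" using True w su by simp
      ultimately show ?thesis using True w by simp
    next
      case False
      have uw: "lt u w"
        using False le_iff_of_ascends(1)[of s w u] w assms y by (auto simp: lt_def)
      let ?N = "{x \<in> between u w. ascends s x}"
      have "(\<Sum>x\<in>?A. psi u (s x) * \<b> * ?E x) = psi u (s w) * \<b> * ?E w + (\<Sum>x\<in>?N. psi u (s x) * \<b> * ?E x)"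
        using sum_ascents_between_inv[OF assms(1,2) w(1) assms(3) w(3) uw, of "\<lambda>x. psi u (s x) * \<b> * ?E x"]
        unfolding w(2) .
      moreover have "(\<Sum>x\<in>?D. psi u x * \<b> * (?E x * \<e>))
          = psi u (s u) * \<b> * (?E (s u) * \<e>) + (\<Sum>x\<in>?N. psi u (s x) * \<b> * (?E (s x) * \<e>))"
        using sum_descents_between_inv[OF assms(1,2) w(1) assms(3) w(3) uw, of "\<lambda>x. psi u x * \<b> * (?E x * \<e>)"]
        unfolding w(2) .
      moreover have E: "?E (s x) * \<e> = ?E x" if "l x < l w" "l (s x) = Suc (l x)" for x
      proof -
        have "l y - l x - 1 = Suc (l y - l (s x) - 1)" using that w(4) by simp
        then show ?thesis by (simp only: power_Suc2)
      qed
      moreover have "?E (s u) * \<e> = ?E u" using E su lt_rank[OF assms(2) w(1) uw] by blast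
      moreover have "(\<Sum>x\<in>?N. psi u (s x) * \<b> * (?E (s x) * \<e>)) = (\<Sum>x\<in>?N. psi u (s x) * \<b> * ?E x)"
      proof (rule sum.cong[OF refl])
        fix x assume "x \<in> ?N"
        then have "?E (s x) * \<e> = ?E x"
          using E between_rank[OF assms(2) w(1), of x] ascends_rank[OF assms(1), of x] by (auto simp: between_def)
        then show "psi u (s x) * \<b> * (?E (s x) * \<e>) = psi u (s x) * \<b> * ?E x" by (simp only:)
      qed
      moreover have "?E w = 1" using w by simp
      ultimately show ?thesis using su w by simp
    qed
    then have "lifted s u y = \<b> * ?E u + psi u y * \<a> + (psi u y * \<b> - \<b> * ?E u)"
      by (simp only: h)
    also have "\<dots> = psi u y * \<c>"
      by (simp add: distrib_left)
    finally show ?thesis using False by simp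
  qed
qed

text \<open>
  Since \<open>-ba = ab - d\<close>, the twisted sum is the sum of all \<open>\<Psi>[u,v] ab \<Psi>[v,w]\<close>, known from
  \<open>ab_deriv_psi\<close>, minus a correction by \<open>d\<close> at the elements that \<open>s\<close> lowers.
\<close>

lemma phi_lifting_recursion:
  assumes "s \<in> M" "u \<in> C" "w \<in> C" "ascends s u" "ascends s w" "lt u w"
  shows "phi u (s w) = nc_var C_letter * phi u w + cd_deriv (phi u w)
    - (\<Sum>v\<in>{v \<in> between u w. \<not> ascends s v}. phi u v * nc_var D_letter * phi v w)"
proof -
  let ?f = "nc_subst cd_in_ab"
  let ?B = "between u w" let ?D = "{v \<in> ?B. \<not> ascends s v}"
  have sw: "s w \<in> C" "lt u (s w)"
    using assms inv_closed[of s w] inv_lt[of s w] lt_trans[of u w "s w"] by auto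
  have twist: "twist s v = \<a> * \<b> - (if ascends s v then 0 else \<d>)" for v
    by (simp add: twist_def)
  have "(\<Sum>v\<in>?B. psi u v * twist s v * psi v w)
      = (\<Sum>v\<in>?B. psi u v * (\<a> * \<b>) * psi v w) - (\<Sum>v\<in>?B. if ascends s v then 0 else psi u v * \<d> * psi v w)"
    unfolding sum_subtractf[symmetric] twist
    by (rule sum.cong[OF refl]) (simp add: algebra_simps)
  also have "(\<Sum>v\<in>?B. if ascends s v then 0 else psi u v * \<d> * psi v w) = (\<Sum>v\<in>?D. psi u v * \<d> * psi v w)"
    unfolding sum_between_split[OF assms(3), of _ u s] by simp
  also have "(\<Sum>v\<in>?D. psi u v * \<d> * psi v w) = (\<Sum>v\<in>?D. ?f (phi u v * nc_var D_letter * phi v w))"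
    using assms by (intro sum.cong refl) (simp add: nc_subst_mult nc_subst_phi between_def)
  finally have sum: "(\<Sum>v\<in>?B. psi u v * twist s v * psi v w) = (\<Sum>v\<in>?B. psi u v * (\<a> * \<b>) * psi v w)
      - ?f (\<Sum>v\<in>?D. phi u v * nc_var D_letter * phi v w)"
    by (simp only: nc_subst_sum)
  have "?f (phi u (s w)) = lifted s u w"
    using lifted_eq[OF assms(1,2,4,3,6)] assms sw by (simp add: nc_subst_phi)
  also have "\<dots> = \<c> * psi u w + ab_deriv (psi u w) - ?f (\<Sum>v\<in>?D. phi u v * nc_var D_letter * phi v w)"
    unfolding lifted_def sum ab_deriv_psi[OF assms(2,3)] by (simp add: algebra_simps)
  also have "\<dots> = ?f (nc_var C_letter * phi u w + cd_deriv (phi u w)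
      - (\<Sum>v\<in>?D. phi u v * nc_var D_letter * phi v w))"
    using assms
    by (simp add: nc_subst_diff nc_subst_add nc_subst_mult nc_subst_phi flip: ab_deriv_cd_in_ab)
  finally show ?thesis
    by (rule nc_subst_cd_inject)
qed

lemma phi_cover:
  assumes "u \<in> C" "v \<in> C" "lt u v" "l v = Suc (l u)"
  shows "phi u v = 1"
  using nc_subst_phi[OF assms(1-3)] psi_cover[OF assms(1,2,4)]
  by (intro nc_subst_cd_inject) simp

end


section \<open>Bruhat order\<close>

context group
begin

lemma inv_cancel_left [simp]:
  "x \<in> carrier G \<Longrightarrow> y \<in> carrier G \<Longrightarrow> inv x \<otimes> (x \<otimes> y) = y"
  "x \<in> carrier G \<Longrightarrow> y \<in> carrier G \<Longrightarrow> x \<otimes> (inv x \<otimes> y) = y"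
  by (simp_all flip: m_assoc)

lemma conjugate_eq_iff:
  assumes "g \<in> carrier G" "x \<in> carrier G" "y \<in> carrier G"
  shows "inv g \<otimes> x \<otimes> g = y \<longleftrightarrow> x = g \<otimes> y \<otimes> inv g"
  using assms by (auto simp: m_assoc)

end

lemma count_list_map_inverse:
  assumes "\<And>x. x \<in> set xs \<Longrightarrow> f x = y \<longleftrightarrow> x = z"
  shows "count_list (map f xs) y = count_list xs z"
  using assms by (induction xs) auto

lemma subseq_snoc_cases:
  assumes "subseq ys (xs @ [s])"
  obtains "subseq ys xs" | zs where "ys = zs @ [s]" "subseq zs xs"
proof -
  obtain ys1 ys2 where ys: "ys = ys1 @ ys2" "subseq ys1 xs" "subseq ys2 [s]"
    using assms by (auto simp: subseq_append_iff)
  then have "ys2 = [] \<or> ys2 = [s]"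
    by (cases ys2) (auto simp: subseq_singleton_left split: if_splits)
  with ys that show ?thesis by auto
qed

lemma subseq_lists: "subseq ys xs \<Longrightarrow> xs \<in> lists A \<Longrightarrow> ys \<in> lists A"
  by (induction rule: list_emb.induct) auto

text \<open>
  Membership in \<open>lists S\<close> is kept as it is, so that it matches the premises of the rules below.
\<close>

declare in_listsD [rule del] in_listsI [rule del]

lemma rev_in_lists [simp]: "rev xs \<in> lists A \<longleftrightarrow> xs \<in> lists A"
  by (simp add: in_lists_conv_set)

context coxeter_system
begin

abbreviation val :: "'a list \<Rightarrow> 'a" where
  "val \<equiv> word_value W"

abbreviation len :: "'a \<Rightarrow> nat" where
  "len \<equiv> cox_length W S"

lemma gen_closed [simp]: "s \<in> S \<Longrightarrow> s \<in> carrier W"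
  using generators_closed by blast

lemma val_Nil [simp]: "val [] = \<one>"
  and val_Cons [simp]: "val (x # xs) = x \<otimes> val xs"
  by (simp_all add: word_value_def)

lemma val_closed [simp]: "xs \<in> lists S \<Longrightarrow> val xs \<in> carrier W"
  by (induction xs) auto

lemma val_append: "xs \<in> lists S \<Longrightarrow> ys \<in> lists S \<Longrightarrow> val (xs @ ys) = val xs \<otimes> val ys"
  by (induction xs) (auto simp: m_assoc)

text \<open>
  Both consequences of the presentation that are used later: equality of words is generated by
  deletion of relators, and the relators themselves are trivial.
\<close>

lemma relators_trivial:
  obtains m where "coxeter_matrix S m"
    "\<And>xs ys. xs \<in> lists S \<Longrightarrow> ys \<in> lists S \<Longrightarrow> val xs = val ys \<longleftrightarrow> equivclp (relator_deletion S m) xs ys"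
    "\<And>s t. s \<in> S \<Longrightarrow> t \<in> S \<Longrightarrow> val (concat (replicate (m s t) [s, t])) = \<one>"
proof -
  obtain m where m: "coxeter_matrix S m"
    "\<forall>xs\<in>lists S. \<forall>ys\<in>lists S. val xs = val ys \<longleftrightarrow> equivclp (relator_deletion S m) xs ys"
    using presentation by blast
  have "val (concat (replicate (m s t) [s, t])) = \<one>" if "s \<in> S" "t \<in> S" for s t
  proof -
    have R: "concat (replicate k [s, t]) \<in> lists S" for k
      using that by (induction k) auto
    have "relator_deletion S m (concat (replicate (m s t) [s, t])) []"
      unfolding relator_deletion_def using that
      by (intro bexI[of _ "[]"] bexI[of _ s] bexI[of _ t]) auto
    then have "equivclp (relator_deletion S m) (concat (replicate (m s t) [s, t])) []"
      by blast
    then have "val (concat (replicate (m s t) [s, t])) = val []"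
      using m(2) R by blast
    then show ?thesis by simp
  qed
  with m that show ?thesis by blast
qed

lemma gen_square [simp]: "s \<in> S \<Longrightarrow> s \<otimes> s = \<one>"
proof -
  assume s: "s \<in> S"
  obtain m where m: "coxeter_matrix S m"
    "\<And>s t. s \<in> S \<Longrightarrow> t \<in> S \<Longrightarrow> val (concat (replicate (m s t) [s, t])) = \<one>"
    using relators_trivial by metis
  have "m s s = 1" using m(1) s by (simp add: coxeter_matrix_def)
  then show ?thesis using m(2)[OF s s] s by simp
qed

lemma gen_square_left [simp]: "s \<in> S \<Longrightarrow> x \<in> carrier W \<Longrightarrow> s \<otimes> (s \<otimes> x) = x"
  by (simp flip: m_assoc)

lemma gen_square_right [simp]: "s \<in> S \<Longrightarrow> x \<in> carrier W \<Longrightarrow> x \<otimes> s \<otimes> s = x"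
  by (simp add: m_assoc)

lemma gen_inv [simp]: "s \<in> S \<Longrightarrow> inv s = s"
  by (simp add: inv_equality)

lemma val_rev: "xs \<in> lists S \<Longrightarrow> val (rev xs) = inv (val xs)"
  by (induction xs) (auto simp: val_append inv_mult_group)

lemma word_exists:
  assumes "w \<in> carrier W"
  shows "\<exists>xs\<in>lists S. val xs = w"
proof -
  have "w \<in> generate W S" using assms generators_generate by simp
  then show ?thesis
  proof (induction rule: generate.induct)
    case one
    then show ?case by (intro bexI[of _ "[]"]) auto
  next
    case (incl h)
    then show ?case by (intro bexI[of _ "[h]"]) auto
  next
    case (inv h)
    then show ?case by (intro bexI[of _ "[h]"]) auto
  next
    case (eng h1 h2)
    then obtain xs ys where "xs \<in> lists S" "val xs = h1" "ys \<in> lists S" "val ys = h2" by blast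
    then show ?case by (intro bexI[of _ "xs @ ys"]) (auto simp: val_append)
  qed
qed

subsection \<open>Length\<close>

lemma reduced_word_exists:
  assumes "w \<in> carrier W"
  shows "\<exists>xs. reduced_word W S w xs"
proof -
  have "\<exists>n. \<exists>xs\<in>lists S. val xs = w \<and> length xs = n" using word_exists[OF assms] by blast
  then have "\<exists>xs\<in>lists S. val xs = w \<and> length xs = len w"
    unfolding cox_length_def by (rule LeastI_ex)
  then show ?thesis by (auto simp: reduced_word_def)
qed

lemma len_le: "xs \<in> lists S \<Longrightarrow> len (val xs) \<le> length xs"
  unfolding cox_length_def by (rule Least_le) auto

lemma len_one [simp]: "len \<one> = 0"
  using len_le[of "[]"] by simp

lemma len_eq_0: "w \<in> carrier W \<Longrightarrow> len w = 0 \<Longrightarrow> w = \<one>"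
  using reduced_word_exists[of w] by (auto simp: reduced_word_def)

lemma len_mult_gen_le:
  assumes "w \<in> carrier W" "s \<in> S"
  shows "len (w \<otimes> s) \<le> Suc (len w)"
proof -
  obtain xs where "reduced_word W S w xs" using reduced_word_exists assms by blast
  then show ?thesis
    using len_le[of "xs @ [s]"] assms by (auto simp: reduced_word_def val_append)
qed

subsection \<open>Reflections and strong exchange\<close>

text \<open>
  For a reduced word these are the reflections \<open>t\<close> with \<open>l(wt) < l(w)\<close>. For an arbitrary word, a
  reflection has this property if and only if it occurs an odd number of times.
\<close>

fun inversions :: "'a list \<Rightarrow> 'a list" where
  "inversions [] = []"
| "inversions (s # xs) = (inv (val xs) \<otimes> s \<otimes> val xs) # inversions xs"

definition reflections :: "'a set" where
  "reflections = {inv g \<otimes> s \<otimes> g | g s. g \<in> carrier W \<and> s \<in> S}"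

lemma conjugate_gen_reflection: "g \<in> carrier W \<Longrightarrow> s \<in> S \<Longrightarrow> inv g \<otimes> s \<otimes> g \<in> reflections"
  unfolding reflections_def by blast

lemma reflection_closed [simp]: "t \<in> reflections \<Longrightarrow> t \<in> carrier W"
  by (auto simp: reflections_def)

lemma reflection_square:
  assumes "t \<in> reflections"
  shows "t \<otimes> t = \<one>"
proof -
  obtain g s where "t = inv g \<otimes> s \<otimes> g" "g \<in> carrier W" "s \<in> S"
    using assms unfolding reflections_def by blast
  then show ?thesis by (simp add: m_assoc)
qed

lemma reflection_cancel: "t \<in> reflections \<Longrightarrow> x \<in> carrier W \<Longrightarrow> x \<otimes> t \<otimes> t = x"
  using reflection_square[of t] by (simp add: m_assoc)

lemma gen_reflection: "s \<in> S \<Longrightarrow> s \<in> reflections"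
  using conjugate_gen_reflection[of \<one> s] by simp

lemma conjugate_reflection:
  assumes "t \<in> reflections" "s \<in> S"
  shows "s \<otimes> t \<otimes> s \<in> reflections"
proof -
  obtain g r where "t = inv g \<otimes> r \<otimes> g" "g \<in> carrier W" "r \<in> S"
    using assms unfolding reflections_def by blast
  then have "s \<otimes> t \<otimes> s = inv (g \<otimes> s) \<otimes> r \<otimes> (g \<otimes> s)"
    using assms(2) by (simp add: inv_mult_group m_assoc)
  moreover have "g \<otimes> s \<in> carrier W" using \<open>g \<in> carrier W\<close> assms(2) by simp
  ultimately show ?thesis
    using \<open>r \<in> S\<close> unfolding reflections_def by blast
qed

lemma inversions_subset: "xs \<in> lists S \<Longrightarrow> set (inversions xs) \<subseteq> reflections"
  by (induction xs) (auto intro: conjugate_gen_reflection)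

lemma inversions_append:
  "xs \<in> lists S \<Longrightarrow> ys \<in> lists S \<Longrightarrow>
    inversions (xs @ ys) = map (\<lambda>t. inv (val ys) \<otimes> t \<otimes> val ys) (inversions xs) @ inversions ys"
  by (induction xs) (auto simp: val_append inv_mult_group m_assoc)

lemma count_inversions_append:
  assumes "xs \<in> lists S" "ys \<in> lists S" "t \<in> carrier W"
  shows "count_list (inversions (xs @ ys)) t
    = count_list (inversions xs) (val ys \<otimes> t \<otimes> inv (val ys)) + count_list (inversions ys) t"
proof -
  have "count_list (map (\<lambda>t. inv (val ys) \<otimes> t \<otimes> val ys) (inversions xs)) t
      = count_list (inversions xs) (val ys \<otimes> t \<otimes> inv (val ys))"
    using inversions_subset[OF assms(1)] reflection_closed assms
    by (intro count_list_map_inverse conjugate_eq_iff) auto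
  then show ?thesis by (simp add: inversions_append assms)
qed

text \<open>
  Multiplication by the reflection that belongs to a letter deletes this letter.
\<close>

lemma delete_inversion:
  assumes "xs \<in> lists S" "t \<in> set (inversions xs)"
  shows "\<exists>ys\<in>lists S. subseq ys xs \<and> length xs = Suc (length ys) \<and> val ys = val xs \<otimes> t"
  using assms
proof (induction xs rule: list.induct)
  case (Cons s xs)
  show ?case
  proof (cases "t \<in> set (inversions xs)")
    case True
    then obtain ys where "ys \<in> lists S" "subseq ys xs" "length xs = Suc (length ys)" "val ys = val xs \<otimes> t"
      using Cons by auto
    moreover have "t \<in> reflections"
    proof -
      have "xs \<in> lists S" using Cons.prems(1) by simp
      then show ?thesis using True inversions_subset by blast
    qed
    ultimately show ?thesis
      using Cons.prems by (intro bexI[of _ "s # ys"]) (auto simp: m_assoc)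
  next
    case False
    then have "t = inv (val xs) \<otimes> s \<otimes> val xs" using Cons.prems by simp
    then show ?thesis
      using Cons.prems by (intro bexI[of _ xs]) (auto simp: m_assoc)
  qed
qed simp

text \<open>
  With \<open>p = s t\<close>, the inversion list of \<open>(s t)\<^sup>k\<close> consists of the reflections \<open>t p\<^sup>i\<close> for
  \<open>i = 2k-1, ..., 0\<close>. If \<open>p\<^sup>k = 1\<close>, then \<open>t p\<^sup>i\<^sup>+\<^sup>k = t p\<^sup>i\<close>, and each reflection occurs twice as often
  as among the exponents below \<open>k\<close>.
\<close>

lemma even_count_relator:
  assumes "s \<in> S" "t \<in> S" "val (concat (replicate k [s, t])) = \<one>"
  shows "even (count_list (inversions (concat (replicate k [s, t]))) x)"
proof -
  let ?R = "\<lambda>k. concat (replicate k [s, t])" and ?p = "s \<otimes> t"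
  have R: "?R j \<in> lists S" for j using assms by (induction j) auto
  have p: "?p \<in> carrier W" using assms by simp
  have valR: "val (?R j) = ?p [^] j" for j
  proof (induction j)
    case (Suc j)
    have "val (?R (Suc j)) = ?p \<otimes> ?p [^] j"
      using Suc assms by (simp add: m_assoc)
    then show ?case using p nat_pow_Suc2[of ?p j] by (simp only:)
  qed simp
  have inv_pow: "inv (?p [^] j) \<otimes> t = t \<otimes> ?p [^] j" for j :: nat
  proof (induction j)
    case (Suc j)
    have "inv (?p [^] Suc j) \<otimes> t = inv ?p \<otimes> (inv (?p [^] j) \<otimes> t)"
      using p assms by (simp add: inv_mult_group m_assoc)
    also have "\<dots> = t \<otimes> (?p \<otimes> ?p [^] j)"
      unfolding Suc using assms p by (simp add: inv_mult_group m_assoc)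
    finally show ?case using nat_pow_Suc2[OF p, of j] by (simp only:)
  qed (use assms in simp)
  \<comment> \<open>As \<open>t\<close> inverts \<open>p\<close>, conjugating a letter by \<open>p\<^sup>j\<close> multiplies it by \<open>p\<^sup>2\<^sup>j\<close>.\<close>
  have two: "inv (?p [^] j) \<otimes> t \<otimes> ?p [^] j = t \<otimes> ?p [^] (2 * j)" for j :: nat
    using p assms by (simp add: inv_pow m_assoc nat_pow_mult mult_2)
  have odd: "inv (?p [^] j) \<otimes> (t \<otimes> ?p) \<otimes> ?p [^] j = t \<otimes> ?p [^] (2 * j + 1)" for j :: nat
  proof -
    have "inv (?p [^] j) \<otimes> (t \<otimes> ?p) \<otimes> ?p [^] j = (inv (?p [^] j) \<otimes> t) \<otimes> (?p \<otimes> ?p [^] j)"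
      using p assms by (simp add: m_assoc)
    also have "?p \<otimes> ?p [^] j = ?p [^] Suc j"
      by (rule nat_pow_Suc2[OF p, symmetric])
    also have "inv (?p [^] j) \<otimes> t \<otimes> ?p [^] Suc j = t \<otimes> (?p [^] j \<otimes> ?p [^] Suc j)"
      unfolding inv_pow using p assms by (simp add: m_assoc del: nat_pow_Suc)
    also have "\<dots> = t \<otimes> ?p [^] (2 * j + 1)"
      using p by (simp only: nat_pow_mult) (simp add: mult_2)
    finally show ?thesis .
  qed
  have cnt: "count_list (inversions (?R j)) x = count_list (map (\<lambda>i. t \<otimes> ?p [^] i) [0..<2 * j]) x" for j
  proof (induction j)
    case (Suc j)
    have "inversions (?R (Suc j)) = inversions ([s, t] @ ?R j)" by simp
    also have "\<dots> = (inv (?p [^] j) \<otimes> (t \<otimes> ?p) \<otimes> ?p [^] j) # (inv (?p [^] j) \<otimes> t \<otimes> ?p [^] j) # inversions (?R j)"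
      using assms by (subst inversions_append[OF _ R]) (simp_all add: valR m_assoc)
    finally have "inversions (?R (Suc j)) = (t \<otimes> ?p [^] (2 * j + 1)) # (t \<otimes> ?p [^] (2 * j)) # inversions (?R j)"
      unfolding two odd .
    then show ?case using Suc by simp
  qed simp
  have "[0..<2 * k] = [0..<k] @ map (\<lambda>i. i + k) [0..<k]"
    by (simp add: map_add_upt upt_add_eq_append[of 0 k k, symmetric] mult_2)
  moreover have "t \<otimes> ?p [^] (i + k) = t \<otimes> ?p [^] i" for i
    using p assms valR[of k] by (simp flip: nat_pow_mult)
  ultimately have "count_list (map (\<lambda>i. t \<otimes> ?p [^] i) [0..<2 * k]) x
      = 2 * count_list (map (\<lambda>i. t \<otimes> ?p [^] i) [0..<k]) x"
    by (simp add: o_def)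
  then show ?thesis by (simp add: cnt)
qed

lemma parity_count_inversions:
  assumes "xs \<in> lists S" "ys \<in> lists S" "val xs = val ys" "t \<in> carrier W"
  shows "even (count_list (inversions xs) t) \<longleftrightarrow> even (count_list (inversions ys) t)"
proof -
  obtain m where m: "coxeter_matrix S m"
    "\<And>xs ys. xs \<in> lists S \<Longrightarrow> ys \<in> lists S \<Longrightarrow> val xs = val ys \<longleftrightarrow> equivclp (relator_deletion S m) xs ys"
    "\<And>s t. s \<in> S \<Longrightarrow> t \<in> S \<Longrightarrow> val (concat (replicate (m s t) [s, t])) = \<one>"
    using relators_trivial by metis
  have deletion: "even (count_list (inversions xs) t) \<longleftrightarrow> even (count_list (inversions ys) t)"
    if deletion: "relator_deletion S m xs ys" for xs ys
  proof -
    obtain ps qs s r where *: "ps \<in> lists S" "qs \<in> lists S" "s \<in> S" "r \<in> S"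
      "xs = ps @ concat (replicate (m s r) [s, r]) @ qs" "ys = ps @ qs"
      using deletion unfolding relator_deletion_def by blast
    let ?R = "concat (replicate (m s r) [s, r])"
    have "concat (replicate k [s, r]) \<in> lists S" for k
      using *(3,4) by (induction k) auto
    then have R: "?R \<in> lists S" .
    have one: "val ?R = \<one>" by (rule m(3)[OF *(3,4)])
    have "even (count_list (inversions ?R) y)" for y
      by (rule even_count_relator[OF *(3,4) one])
    moreover have "count_list (inversions xs) t = count_list (inversions ps) (val qs \<otimes> t \<otimes> inv (val qs))
        + (count_list (inversions ?R) (val qs \<otimes> t \<otimes> inv (val qs)) + count_list (inversions qs) t)"
      unfolding *(5) using * R assms(4) by (simp add: count_inversions_append val_append one)
    moreover have "count_list (inversions ys) t = count_list (inversions ps) (val qs \<otimes> t \<otimes> inv (val qs))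
        + count_list (inversions qs) t"
      unfolding *(6) using * assms(4) by (simp add: count_inversions_append)
    ultimately show ?thesis by simp
  qed
  have "equivclp (relator_deletion S m) xs ys" using m(2) assms by blast
  then show ?thesis
  proof (induction rule: equivclp_induct)
    case (step y z)
    then show ?case using deletion by blast
  qed simp
qed

text \<open>
  In the palindromic word for \<open>t\<close> the middle letter contributes \<open>t\<close> itself. The two halves together
  contribute as often as in the word with the middle letter removed, which represents \<open>1\<close>, hence
  evenly often.
\<close>

lemma odd_count_self:
  assumes "u \<in> lists S" "s \<in> S" "t = inv (val u) \<otimes> s \<otimes> val u"
  shows "odd (count_list (inversions (rev u @ [s] @ u)) t)"
proof -
  have t: "t \<in> carrier W" "val u \<otimes> t \<otimes> inv (val u) = s" "s \<otimes> val u \<otimes> t \<otimes> inv (s \<otimes> val u) = s"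
    using assms by (auto simp: m_assoc inv_mult_group)
  have ru: "rev u \<in> lists S" using assms by auto
  have "even (count_list (inversions (rev u @ u)) t) \<longleftrightarrow> even (count_list (inversions []) t)"
    using assms ru t by (intro parity_count_inversions) (auto simp: val_append val_rev)
  then have "even (count_list (inversions (rev u)) s + count_list (inversions u) t)"
    using assms ru t by (simp add: count_inversions_append)
  moreover have "count_list (inversions (rev u @ [s] @ u)) t
      = count_list (inversions (rev u)) s + Suc (count_list (inversions u) t)"
    using assms ru t by (subst count_inversions_append) (auto simp: val_append)
  ultimately show ?thesis by simp
qed

lemma parity_mult_reflection:
  assumes "xs \<in> lists S" "zs \<in> lists S" "t \<in> reflections" "val zs = val xs \<otimes> t"
  shows "odd (count_list (inversions zs) t) \<longleftrightarrow> even (count_list (inversions xs) t)"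
proof -
  obtain g s where gs: "t = inv g \<otimes> s \<otimes> g" "g \<in> carrier W" "s \<in> S"
    using assms unfolding reflections_def by blast
  obtain u where u: "u \<in> lists S" "val u = g" using word_exists gs by blast
  let ?ys = "rev u @ [s] @ u"
  have ys: "?ys \<in> lists S" "val ?ys = t"
    using u gs by (auto simp: val_append val_rev m_assoc)
  have t: "t \<in> carrier W" "inv t = t" "t \<otimes> t \<otimes> t = t"
    using reflection_square[of t] assms(3) by (auto simp: inv_equality)
  have "even (count_list (inversions zs) t) \<longleftrightarrow> even (count_list (inversions (xs @ ?ys)) t)"
    using assms ys t by (intro parity_count_inversions) (auto simp: val_append)
  also have "count_list (inversions (xs @ ?ys)) t
      = count_list (inversions xs) t + count_list (inversions ?ys) t"
    using count_inversions_append[OF assms(1) ys(1) t(1)] ys t by simp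
  finally show ?thesis
    using odd_count_self[OF u(1) gs(3), of t] gs u by simp
qed

text \<open>
  An odd count is non-zero in a reduced word as well, and there \<open>t\<close> deletes a letter.
\<close>

lemma len_less_of_odd:
  assumes "xs \<in> lists S" "t \<in> reflections" "odd (count_list (inversions xs) t)"
  shows "len (val xs \<otimes> t) < len (val xs)"
proof -
  obtain zs where zs: "zs \<in> lists S" "val zs = val xs" "length zs = len (val xs)"
    using reduced_word_exists[of "val xs"] assms(1) by (auto simp: reduced_word_def)
  then have "odd (count_list (inversions zs) t)"
    using parity_count_inversions[of xs zs t] assms by simp
  then have "t \<in> set (inversions zs)"
    by (metis count_list_0_iff even_zero)
  then obtain ys where "ys \<in> lists S" "length zs = Suc (length ys)" "val ys = val zs \<otimes> t"
    using delete_inversion zs by blast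
  then show ?thesis using len_le[of ys] zs by simp
qed

text \<open>
  If the count for \<open>w\<close> is even, the one for \<open>wt\<close> is odd, so that \<open>l(w) < l(wt)\<close> by the previous
  lemma.
\<close>

lemma len_less_iff_odd:
  assumes "xs \<in> lists S" "t \<in> reflections"
  shows "len (val xs \<otimes> t) < len (val xs) \<longleftrightarrow> odd (count_list (inversions xs) t)"
proof
  assume less: "len (val xs \<otimes> t) < len (val xs)"
  show "odd (count_list (inversions xs) t)"
  proof (rule ccontr)
    assume even: "\<not> ?thesis"
    obtain zs where zs: "zs \<in> lists S" "val zs = val xs \<otimes> t"
      using word_exists[of "val xs \<otimes> t"] assms by auto
    then have "odd (count_list (inversions zs) t)"
      using parity_mult_reflection[of xs zs t] assms even by simp
    then have "len (val xs \<otimes> t \<otimes> t) < len (val xs \<otimes> t)"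
      using len_less_of_odd[of zs t] zs assms by simp
    then show False using less assms by (simp add: reflection_cancel)
  qed
qed (rule len_less_of_odd[OF assms])

lemma len_mult_reflection_neq:
  assumes "w \<in> carrier W" "t \<in> reflections"
  shows "len (w \<otimes> t) \<noteq> len w"
proof -
  obtain xs where xs: "xs \<in> lists S" "val xs = w" using word_exists assms by blast
  obtain zs where zs: "zs \<in> lists S" "val zs = val xs \<otimes> t"
    using word_exists[of "val xs \<otimes> t"] xs assms by auto
  show ?thesis
    using len_less_iff_odd[OF xs(1) assms(2)] len_less_iff_odd[OF zs(1) assms(2)]
      parity_mult_reflection[OF xs(1) zs(1) assms(2) zs(2)] xs zs assms
    by (auto simp: reflection_cancel)
qed

lemma strong_exchange:
  assumes "xs \<in> lists S" "t \<in> reflections" "len (val xs \<otimes> t) < len (val xs)"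
  shows "t \<in> set (inversions xs)"
  using assms len_less_iff_odd[of xs t] by (metis count_list_0_iff even_zero)

lemma len_mult_gen:
  assumes "w \<in> carrier W" "s \<in> S"
  shows "len (w \<otimes> s) = Suc (len w) \<or> len w = Suc (len (w \<otimes> s))"
  using len_mult_gen_le[OF assms] len_mult_gen_le[of "w \<otimes> s" s] assms
    len_mult_reflection_neq[OF assms(1) gen_reflection[OF assms(2)]] by auto

subsection \<open>The subword property\<close>

text \<open>
  The reflexive transitive closure of this relation is the usual definition of Bruhat order; in
  contrast to the subword order it is transitive by construction.
\<close>

definition reflection_step :: "'a \<Rightarrow> 'a \<Rightarrow> bool" where
  "reflection_step v w \<longleftrightarrow> v \<in> carrier W \<and> (\<exists>t\<in>reflections. w = v \<otimes> t) \<and> len v < len w"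

lemma reflection_step_gen:
  "w \<in> carrier W \<Longrightarrow> s \<in> S \<Longrightarrow> len w < len (w \<otimes> s) \<Longrightarrow> reflection_step w (w \<otimes> s)"
  using gen_reflection by (auto simp: reflection_step_def)

text \<open>
  If \<open>w = vt\<close>, then \<open>ws = vs \<cdot> sts\<close>, so \<open>vs\<close> and \<open>ws\<close> are comparable. The only bad case is
  \<open>v < vs\<close> and \<open>ws < vs\<close>: then strong exchange deletes a letter from a reduced word of \<open>v\<close> followed
  by \<open>s\<close>. The deleted letter is not the final \<open>s\<close> unless \<open>t = s\<close>, so a letter of \<open>v\<close> is deleted to
  give \<open>w\<close>, against \<open>l(v) < l(w)\<close>.
\<close>

lemma reflection_step_lift:
  assumes "reflection_step v w" "s \<in> S"
  shows "reflection_step\<^sup>*\<^sup>* (v \<otimes> s) w \<or> reflection_step\<^sup>*\<^sup>* (v \<otimes> s) (w \<otimes> s)"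
proof -
  obtain t where t: "v \<in> carrier W" "t \<in> reflections" "w = v \<otimes> t" "len v < len w"
    using assms by (auto simp: reflection_step_def)
  let ?t = "s \<otimes> t \<otimes> s"
  have t': "?t \<in> reflections" "w \<otimes> s = v \<otimes> s \<otimes> ?t"
    using t assms conjugate_reflection by (auto simp: m_assoc)
  consider "t = s" | "len (v \<otimes> s) < len v" | "len (v \<otimes> s) < len (w \<otimes> s)"
    | "t \<noteq> s" "len v < len (v \<otimes> s)" "len (w \<otimes> s) < len (v \<otimes> s)"
    using len_mult_reflection_neq[of "v \<otimes> s" ?t] len_mult_gen[of v s] t t' assms by force
  then show ?thesis
  proof cases
    case 1
    then show ?thesis using t by simp
  next
    case 2
    then have "reflection_step (v \<otimes> s) v"
      using reflection_step_gen[of "v \<otimes> s" s] t assms by simp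
    then show ?thesis using assms(1) by (meson converse_rtranclp_into_rtranclp r_into_rtranclp)
  next
    case 3
    then have "reflection_step (v \<otimes> s) (w \<otimes> s)"
      using t t' assms by (auto simp: reflection_step_def)
    then show ?thesis by blast
  next
    case 4
    obtain xs where xs: "xs \<in> lists S" "val xs = v" "length xs = len v"
      using reduced_word_exists[OF t(1)] by (auto simp: reduced_word_def)
    have "?t \<in> set (inversions (xs @ [s]))"
      using 4 xs t t' assms by (intro strong_exchange) (auto simp: val_append)
    then have "?t = s \<or> ?t \<in> (\<lambda>t. s \<otimes> t \<otimes> s) ` set (inversions xs)"
      using xs assms by (auto simp: inversions_append)
    moreover have inj: "r = r'" if "s \<otimes> r \<otimes> s = s \<otimes> r' \<otimes> s" "r \<in> carrier W" "r' \<in> carrier W" for r r'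
      using that assms by simp
    moreover have "?t \<noteq> s"
      using inj[of t s] 4(1) t assms by (auto simp: m_assoc)
    ultimately obtain r where "r \<in> set (inversions xs)" "s \<otimes> t \<otimes> s = s \<otimes> r \<otimes> s" by auto
    moreover from this have "r \<in> reflections" using inversions_subset xs by blast
    ultimately have "t \<in> set (inversions xs)" using inj[of t r] t by simp
    then obtain ys where "ys \<in> lists S" "length xs = Suc (length ys)" "val ys = w"
      using delete_inversion xs t by blast
    then have False using len_le[of ys] xs t by simp
    then show ?thesis ..
  qed
qed

lemma reflection_order_lift:
  assumes "reflection_step\<^sup>*\<^sup>* v w" "s \<in> S"
  shows "reflection_step\<^sup>*\<^sup>* (v \<otimes> s) w \<or> reflection_step\<^sup>*\<^sup>* (v \<otimes> s) (w \<otimes> s)"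
  using assms(1)
proof (induction rule: converse_rtranclp_induct)
  case (step v v')
  then show ?case
    using reflection_step_lift[OF step(1) assms(2)] by (meson rtranclp_trans)
qed simp

lemma reduced_butlast:
  assumes "xs \<in> lists S" "s \<in> S" "length (xs @ [s]) = len (val (xs @ [s]))"
  shows "length xs = len (val xs)" "len (val xs) < len (val xs \<otimes> s)"
  using assms len_le[of xs] len_mult_gen_le[of "val xs" s] by (auto simp: val_append)

text \<open>
  Induction on the word: if the subword uses the last letter \<open>s\<close>, remove \<open>s\<close> from both words and
  lift the resulting relation along \<open>s\<close>.
\<close>

lemma subword_imp_reflection_order:
  assumes "xs \<in> lists S" "length xs = len (val xs)" "subseq ys xs"
  shows "reflection_step\<^sup>*\<^sup>* (val ys) (val xs)"
  using assms
proof (induction xs arbitrary: ys rule: rev_induct)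
  case (snoc s xs)
  then have xs: "xs \<in> lists S" "s \<in> S" by auto
  note red = reduced_butlast[OF xs snoc.prems(2)]
  have step: "reflection_step (val xs) (val xs \<otimes> s)"
    using red xs by (intro reflection_step_gen) auto
  have val: "val (xs @ [s]) = val xs \<otimes> s" using xs by (simp add: val_append)
  from snoc.prems(3) show ?case
  proof (cases rule: subseq_snoc_cases)
    case 1
    then show ?thesis using snoc.IH[OF xs(1) red(1)] step unfolding val by (meson rtranclp.rtrancl_into_rtrancl)
  next
    case (2 zs)
    have zs: "zs \<in> lists S" using 2(2) xs(1) by (rule subseq_lists)
    have ys: "val ys = val zs \<otimes> s" using 2 zs xs by (simp add: val_append)
    have "reflection_step\<^sup>*\<^sup>* (val ys) (val xs) \<or> reflection_step\<^sup>*\<^sup>* (val ys) (val xs \<otimes> s)"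
      unfolding ys by (rule reflection_order_lift[OF snoc.IH[OF xs(1) red(1) 2(2)] xs(2)])
    then show ?thesis using step unfolding val by (meson rtranclp.rtrancl_into_rtrancl)
  qed
qed (auto dest: list_emb_Nil2)

text \<open>
  Going down one step deletes a letter by strong exchange, which does not require the current
  word to be reduced.
\<close>

lemma reflection_order_imp_subword:
  assumes "reflection_step\<^sup>*\<^sup>* v (val xs)" "xs \<in> lists S"
  shows "\<exists>ys\<in>lists S. subseq ys xs \<and> val ys = v"
  using assms(1)
proof (induction rule: converse_rtranclp_induct)
  case base
  then show ?case using assms(2) by auto
next
  case (step v v')
  then obtain ys where ys: "ys \<in> lists S" "subseq ys xs" "val ys = v'" by blast
  obtain t where t: "t \<in> reflections" "v' = v \<otimes> t" "v \<in> carrier W" "len v < len v'"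
    using step(1) by (auto simp: reflection_step_def)
  have "v' \<otimes> t = v" using t by (simp add: reflection_cancel)
  then have "t \<in> set (inversions ys)"
    using ys t by (intro strong_exchange) auto
  then obtain zs where "zs \<in> lists S" "subseq zs ys" "val zs = v"
    using delete_inversion[of ys t] ys \<open>v' \<otimes> t = v\<close> by auto
  then show ?case using ys subseq_order.order_trans by blast
qed

text \<open>
  Process the letters one by one: a letter that would lower the length deletes an earlier letter
  instead.
\<close>

lemma reduced_subword_exists:
  assumes "xs \<in> lists S"
  shows "\<exists>ys. subseq ys xs \<and> reduced_word W S (val xs) ys"
  using assms
proof (induction xs rule: rev_induct)
  case Nil
  then show ?case by (simp add: reduced_word_def)
next
  case (snoc s xs)
  then have xs: "xs \<in> lists S" "s \<in> S" by auto
  obtain ys where ys: "subseq ys xs" "ys \<in> lists S" "val ys = val xs" "length ys = len (val xs)"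
    using snoc xs by (auto simp: reduced_word_def)
  have val: "val (xs @ [s]) = val xs \<otimes> s" using xs by (simp add: val_append)
  show ?case
  proof (cases "len (val xs \<otimes> s) = Suc (len (val xs))")
    case True
    moreover have "subseq (ys @ [s]) (xs @ [s])" using ys(1) by simp
    ultimately show ?thesis
      using ys xs unfolding val by (intro exI[of _ "ys @ [s]"]) (simp add: reduced_word_def val_append)
  next
    case False
    then have less: "len (val xs) = Suc (len (val xs \<otimes> s))"
      using len_mult_gen[of "val xs" s] xs by auto
    then have "s \<in> set (inversions ys)"
      using ys xs gen_reflection by (intro strong_exchange) auto
    then obtain zs where zs: "zs \<in> lists S" "subseq zs ys" "length ys = Suc (length zs)" "val zs = val ys \<otimes> s"
      using delete_inversion ys by blast
    have "subseq zs (xs @ [s])"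
      using zs(2) ys(1) by (meson subseq_order.order_trans subseq_rev_drop_many)
    then show ?thesis
      using zs ys less unfolding val by (intro exI[of _ zs]) (simp add: reduced_word_def)
  qed
qed

lemma bruhat_le_iff:
  assumes "v \<in> carrier W" "w \<in> carrier W"
  shows "bruhat_le W S v w \<longleftrightarrow> reflection_step\<^sup>*\<^sup>* v w"
proof
  assume "bruhat_le W S v w"
  then obtain xs ys where "reduced_word W S w xs" "subseq ys xs" "reduced_word W S v ys"
    unfolding bruhat_le_def by blast
  then show "reflection_step\<^sup>*\<^sup>* v w"
    using subword_imp_reflection_order[of xs ys] by (simp add: reduced_word_def)
next
  assume *: "reflection_step\<^sup>*\<^sup>* v w"
  obtain xs where xs: "reduced_word W S w xs" using reduced_word_exists assms by blast
  then obtain ys where ys: "ys \<in> lists S" "subseq ys xs" "val ys = v"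
    using reflection_order_imp_subword[of v xs] * by (auto simp: reduced_word_def)
  then obtain zs where "subseq zs ys" "reduced_word W S v zs"
    using reduced_subword_exists by blast
  then show "bruhat_le W S v w"
    unfolding bruhat_le_def using xs ys(2) subseq_order.order_trans by blast
qed

text \<open>
  Choose a reduced word of \<open>ws\<close> that ends in \<open>s\<close> and in it a reduced word of \<open>x\<close>. The latter does
  not use the final \<open>s\<close>, as \<open>s\<close> is not a descent of \<open>x\<close>.
\<close>

lemma bruhat_lift_down:
  assumes "x \<in> carrier W" "w \<in> carrier W" "s \<in> S" "len x < len (x \<otimes> s)" "len w < len (w \<otimes> s)"
    "reflection_step\<^sup>*\<^sup>* x (w \<otimes> s)"
  shows "reflection_step\<^sup>*\<^sup>* x w"
proof -
  obtain xs where xs: "xs \<in> lists S" "val xs = w" "length xs = len w"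
    using reduced_word_exists[OF assms(2)] by (auto simp: reduced_word_def)
  have "val (xs @ [s]) = w \<otimes> s" using xs assms by (simp add: val_append)
  then obtain ys where "ys \<in> lists S" "subseq ys (xs @ [s])" "val ys = x"
    using reflection_order_imp_subword[of x "xs @ [s]"] xs assms by auto
  then obtain zs where zs: "subseq zs (xs @ [s])" "zs \<in> lists S" "val zs = x" "length zs = len x"
    using reduced_subword_exists[of ys] subseq_order.order_trans by (auto simp: reduced_word_def)
  from zs(1) show ?thesis
  proof (cases rule: subseq_snoc_cases)
    case 1
    then show ?thesis using subword_imp_reflection_order[of xs zs] xs zs by simp
  next
    case (2 us)
    then have us: "us \<in> lists S" using zs by simp
    then have "x \<otimes> s = val us" using 2 zs assms by (auto simp: val_append)
    then show ?thesis using len_le[OF us] 2 zs assms by simp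
  qed
qed

lemma reflection_order_len:
  "reflection_step\<^sup>*\<^sup>* v w \<Longrightarrow> v \<noteq> w \<Longrightarrow> len v < len w"
proof (induction rule: converse_rtranclp_induct)
  case (step v v')
  then show ?case by (cases "v' = w") (auto simp: reflection_step_def)
qed simp

lemma descent_exists:
  assumes "w \<in> carrier W" "0 < len w"
  shows "\<exists>s\<in>S. len (w \<otimes> s) < len w"
proof -
  obtain xs where xs: "xs \<in> lists S" "val xs = w" "length xs = len w"
    using reduced_word_exists[OF assms(1)] by (auto simp: reduced_word_def)
  then obtain ys s where "xs = ys @ [s]" using assms by (cases xs rule: rev_cases) auto
  then have "ys \<in> lists S" "s \<in> S" "w \<otimes> s = val ys" "len w = Suc (length ys)"
    using xs by (auto simp: val_append)
  then show ?thesis using len_le[of ys] by (intro bexI[of _ s]) auto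
qed

end

lemma (in coxeter_system) lifting_poset_bruhat:
  "lifting_poset (carrier W) (bruhat_le W S) (cox_length W S) ((\<lambda>s x. x \<otimes> s) ` S)"
proof
  fix x y z assume "x \<in> carrier W" "y \<in> carrier W" "z \<in> carrier W" "bruhat_le W S x y" "bruhat_le W S y z"
  then show "bruhat_le W S x z" by (simp add: bruhat_le_iff)
next
  fix x y assume "x \<in> carrier W" "y \<in> carrier W" "bruhat_le W S x y" "x \<noteq> y"
  then show "len x < len y" by (simp add: bruhat_le_iff reflection_order_len)
next
  fix y assume y: "y \<in> carrier W"
  obtain ys where ys: "ys \<in> lists S" "val ys = y" using word_exists y by blast
  have "{x \<in> carrier W. bruhat_le W S x y} \<subseteq> val ` set (subseqs ys)"
  proof
    fix x assume "x \<in> {x \<in> carrier W. bruhat_le W S x y}"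
    then have "reflection_step\<^sup>*\<^sup>* x (val ys)" using y ys bruhat_le_iff[of x y] by auto
    then obtain xs where "subseq xs ys" "val xs = x" using reflection_order_imp_subword ys by blast
    then show "x \<in> val ` set (subseqs ys)" by auto
  qed
  then show "finite {x \<in> carrier W. bruhat_le W S x y}" by (rule finite_subset) simp
next
  fix f x assume "f \<in> (\<lambda>s x. x \<otimes> s) ` S" "x \<in> carrier W" "len x < len (f x)"
  then show "bruhat_le W S x (f x)"
    by (auto simp: bruhat_le_iff intro!: r_into_rtranclp reflection_step_gen)
next
  fix f x y assume *: "f \<in> (\<lambda>s x. x \<otimes> s) ` S" "x \<in> carrier W" "y \<in> carrier W"
    "len x < len (f x)" "len y < len (f y)"
  then obtain s where s: "s \<in> S" "f = (\<lambda>x. x \<otimes> s)" by blast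
  show "bruhat_le W S x y" if "bruhat_le W S x (f y)"
    using bruhat_lift_down[of x y s] that * s by (simp add: bruhat_le_iff)
  show "bruhat_le W S (f x) (f y)" if "bruhat_le W S x y"
    using reflection_order_lift[of x y s] reflection_step_gen[of y s] that * s
    by (auto simp: bruhat_le_iff)
qed (use len_mult_gen descent_exists in \<open>auto simp: bruhat_le_iff\<close>)

lemma (in coxeter_system) one_bruhat_le: "w \<in> carrier W \<Longrightarrow> bruhat_le W S \<one> w"
  unfolding bruhat_le_def using reduced_word_exists[of w]
  by (auto simp: reduced_word_def intro!: exI[of _ "[]"])


section \<open>Comparison with Boolean algebras\<close>

definition toggle :: "nat \<Rightarrow> nat set \<Rightarrow> nat set" where
  "toggle i A = (if i \<in> A then A - {i} else insert i A)"

text \<open>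
  All finite subsets of the natural numbers are taken together, so that Boolean algebras of
  different ranks are intervals of one poset and toggling \<open>n\<close> leads from one to the next.
\<close>

interpretation boolean: lifting_poset "{A :: nat set. finite A}" "(\<subseteq>)" card "range toggle"
proof
  fix A :: "nat set" assume "A \<in> {A. finite A}" "0 < card A"
  then obtain i where "i \<in> A" "finite A" by fastforce
  then have "card (toggle i A) < card A"
    using card_Diff1_less[of A i] by (simp only: toggle_def if_True)
  then show "\<exists>s\<in>range toggle. card (s A) < card A" by blast
next
  fix s and A :: "nat set" assume "s \<in> range toggle" "A \<in> {A. finite A}"
  then obtain i where "s = toggle i" "finite A" by blast
  then show "card (s A) = Suc (card A) \<or> card A = Suc (card (s A))"
    using card_Suc_Diff1[of A i] by (cases "i \<in> A") (simp_all only: toggle_def if_True if_False card_insert_disjoint simp_thms)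
next
  fix s and A B :: "nat set"
  assume *: "s \<in> range toggle" "A \<in> {A. finite A}" "B \<in> {A. finite A}" "card A < card (s A)" "card B < card (s B)"
  then obtain i where i: "s = toggle i" by blast
  have "i \<notin> A" "i \<notin> B"
    using * i by (auto simp: toggle_def split: if_splits dest: card_Diff1_less)
  then show "A \<subseteq> s B \<Longrightarrow> A \<subseteq> B" "A \<subseteq> B \<Longrightarrow> s A \<subseteq> s B"
    using i by (auto simp: toggle_def)
qed (auto simp: toggle_def psubset_card_mono card_mono intro: psubset_card_mono split: if_splits dest: card_Diff1_less)

lemma boolean_algebra_poset_eq:
  "boolean_algebra_poset n = interval_poset \<lparr>carrier = {A. finite A}, eq = (=), le = (\<subseteq>)\<rparr> {} {..<n}"
  by (auto simp: boolean_algebra_poset_def interval_poset_def at_least_at_most_def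
      intro: finite_subset)

lemma boolean_lt: "boolean.lt A B \<longleftrightarrow> A \<subset> B"
  by (auto simp: boolean.lt_def)

text \<open>
  Toggling \<open>n\<close> raises every subset of \<open>{0,...,n-1}\<close>, so there is nothing to subtract. The bound
  \<open>0 < n\<close> is needed because \<open>phi_lifting_recursion\<close> concerns proper intervals.
\<close>

lemma boolean_phi_Suc:
  assumes "0 < n"
  shows "boolean.phi {} {..<Suc n}
    = nc_var C_letter * boolean.phi {} {..<n} + cd_deriv (boolean.phi {} {..<n})"
proof -
  have toggle: "toggle n {..<n} = {..<Suc n}" "toggle n {} = {n}" by (auto simp: toggle_def)
  have "card A < card (toggle n A)" if "A \<in> boolean.between {} {..<n}" for A
    using that by (auto simp: boolean.between_def boolean_lt toggle_def)
  then have no_descents: "{A \<in> boolean.between {} {..<n}. \<not> card A < card (toggle n A)} = {}"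
    by blast
  have "boolean.lt {} {..<n}" using assms by (auto simp: boolean_lt)
  then have "boolean.phi {} (toggle n {..<n}) =
      nc_var C_letter * boolean.phi {} {..<n} + cd_deriv (boolean.phi {} {..<n})
      - (\<Sum>A\<in>{A \<in> boolean.between {} {..<n}. \<not> card A < card (toggle n A)}.
          boolean.phi {} A * nc_var D_letter * boolean.phi A {..<n})"
    by (intro boolean.phi_lifting_recursion) (simp_all add: toggle)
  then show ?thesis
    unfolding no_descents toggle by simp
qed

theorem theorem7p4:
  fixes W :: "'a monoid" and S :: "'a set" and w :: 'a
  assumes cd_nonneg:
    "\<And>(W' :: 'a monoid) S' u v.
       coxeter_system W' S' \<Longrightarrow> u \<in> carrier W' \<Longrightarrow> v \<in> carrier W' \<Longrightarrow>
       u \<sqsubset>\<^bsub>bruhat_order W' S'\<^esub> v \<Longrightarrow>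
       coeffs_nonneg (cd_index (interval_poset (bruhat_order W' S') u v))"
    and "coxeter_system W S"
    and "w \<in> carrier W"
    and "w \<noteq> \<one>\<^bsub>W\<^esub>"
  shows "coeffs_le
           (cd_index (interval_poset (bruhat_order W S) \<one>\<^bsub>W\<^esub> w))
           (cd_index (boolean_algebra_poset (cox_length W S w)))"
proof -
  interpret coxeter_system W S by fact
  interpret bruhat: lifting_poset "carrier W" "bruhat_le W S" "cox_length W S" "(\<lambda>s x. x \<otimes>\<^bsub>W\<^esub> s) ` S"
    by (rule lifting_poset_bruhat)
  have phi: "bruhat.phi u v = cd_index (interval_poset (bruhat_order W S) u v)" for u v
    by (simp add: bruhat.phi_def bruhat_order_def)
  have nonneg: "coeffs_nonneg (bruhat.phi u v)"
    if "u \<in> carrier W" "v \<in> carrier W" "bruhat.lt u v" for u v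
    unfolding phi using assms(2) that
    by (intro cd_nonneg) (auto simp: bruhat.lt_def lless_def bruhat_order_def)
  have one_lt: "bruhat.lt \<one>\<^bsub>W\<^esub> v" if "v \<in> carrier W" "0 < len v" for v
    using one_bruhat_le that by (auto simp: bruhat.lt_def)
  have "coeffs_le (bruhat.phi \<one>\<^bsub>W\<^esub> w) (boolean.phi {} {..<Suc n})"
    if "w \<in> carrier W" "len w = Suc n" for n w
    using that
    \<comment> \<open>The induction starts at length \<open>1\<close>: the interval has to be proper.\<close>
  proof (induction n arbitrary: w)
    case 0
    then have "bruhat.phi \<one>\<^bsub>W\<^esub> w = 1"
      using one_lt by (intro bruhat.phi_cover) auto
    moreover have "boolean.phi {} {..<Suc 0} = 1"
      by (intro boolean.phi_cover) (auto simp: boolean_lt)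
    ultimately show ?case by (simp add: coeffs_le_def)
  next
    case (Suc n)
    let ?B = "boolean.phi {} {..<Suc n}"
    obtain s where s: "s \<in> S" "len (w \<otimes>\<^bsub>W\<^esub> s) < len w" using descent_exists[of w] Suc.prems by auto
    define w' where "w' = w \<otimes>\<^bsub>W\<^esub> s"
    have w': "w' \<in> carrier W" "w' \<otimes>\<^bsub>W\<^esub> s = w" "len w' = Suc n"
      using s Suc.prems len_mult_gen[of w s] by (auto simp: w'_def)
    let ?P = "bruhat.phi \<one>\<^bsub>W\<^esub> w'"
    let ?D = "{v \<in> bruhat.between \<one>\<^bsub>W\<^esub> w'. \<not> len v < len (v \<otimes>\<^bsub>W\<^esub> s)}"
    let ?Q = "\<Sum>v\<in>?D. bruhat.phi \<one>\<^bsub>W\<^esub> v * nc_var D_letter * bruhat.phi v w'"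
    have "len \<one>\<^bsub>W\<^esub> < len (\<one>\<^bsub>W\<^esub> \<otimes>\<^bsub>W\<^esub> s)" using len_mult_gen[of "\<one>\<^bsub>W\<^esub>" s] s by simp
    then have P: "bruhat.phi \<one>\<^bsub>W\<^esub> w = nc_var C_letter * ?P + cd_deriv ?P - ?Q"
      using bruhat.phi_lifting_recursion[of "\<lambda>x. x \<otimes>\<^bsub>W\<^esub> s" "\<one>\<^bsub>W\<^esub>" w'] s w' one_lt[of w'] Suc.prems by simp
    have B: "boolean.phi {} {..<Suc (Suc n)} = nc_var C_letter * ?B + cd_deriv ?B"
      by (rule boolean_phi_Suc) simp
    have IH: "coeffs_nonneg (?B - ?P)"
      using Suc.IH[OF w'(1,3)] by (simp add: coeffs_le_iff_nonneg_diff)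
    \<comment> \<open>the only use of the non-negativity hypothesis\<close>
    have "coeffs_nonneg ?Q"
      using w' by (intro coeffs_nonneg_sum coeffs_nonneg_mult nonneg coeffs_nonneg_var)
        (auto simp: bruhat.between_def)
    moreover have "boolean.phi {} {..<Suc (Suc n)} - bruhat.phi \<one>\<^bsub>W\<^esub> w
        = nc_var C_letter * (?B - ?P) + cd_deriv (?B - ?P) + ?Q"
      unfolding P B cd_deriv_def by (simp add: nc_deriv_diff right_diff_distrib)
    ultimately show ?case
      using IH unfolding coeffs_le_iff_nonneg_diff
      by (simp add: coeffs_nonneg_add coeffs_nonneg_mult coeffs_nonneg_cd_deriv)
  qed
  moreover have "0 < len w" using len_eq_0 assms(3,4) by blast
  ultimately have "coeffs_le (bruhat.phi \<one>\<^bsub>W\<^esub> w) (boolean.phi {} {..<len w})"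
    using assms(3) by (metis Suc_pred)
  then show ?thesis
    by (simp add: phi boolean.phi_def boolean_algebra_poset_eq)
qed

end
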